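(* Let $G$ be a triangle-free graph with maximum degree $\Delta(G)=\Delta$ and minimum degree $\delta(G)=\delta$. If $\delta\ge 6\log(\Delta)+2$, then $$\mathrm{ch}_2(G)\le \mathrm{ch}(G)+\frac{86\Delta}{\delta}.$$ In particular, if $G$ is a triangle-free regular graph (of any degree), then $\mathrm{ch}_2(G)\le \mathrm{ch}(G)+86$.
   Context: Graphs are finite and simple; $\log$ is the natural logarithm (so the hypothesis $\delta\ge 6\log(\Delta)+2$ is understood with $\Delta\ge 1$). A graph is regular if its maximum and minimum degrees coincide. $N_G(v)$ is the set of neighbors of $v$ and $d_G(v)=|N_G(v)|$. The choice number $\mathrm{ch}(G)$ is the least $k$ such that for every assignment of sets (lists) $L(v)$ with $|L(v)|\ge k$ to the vertices $v\in V(G)$ there is a proper coloring $f$ of $G$ with $f(v)\in L(v)$ for all $v$. A $2$-dynamic coloring of $G$ is a proper coloring $f$ such that $|f(N_G(v))|\ge\min\{2,d_G(v)\}$ for every vertex $v$. The $2$-dynamic choosability $\mathrm{ch}_2(G)$ is the least positive integer $k$ such that for every assignment of lists $L(v)$ with $|L(v)|\ge k$ to the vertices $v\in V(G)$ there is a $2$-dynamic coloring $f$ of $G$ with $f(v)\in L(v)$ for all $v\in V(G)$. *)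

theory Defs
  imports Complex_Main "Graph_Theory.Digraph"
begin

text \<open>
  Finite simple graphs are the symmetric digraphs of the locale \<^locale>\<open>graph\<close>, where an
  edge \<open>uv\<close> is represented by the two arcs \<open>u \<rightarrow>\<^bsub>G\<^esub> v\<close> and \<open>v \<rightarrow>\<^bsub>G\<^esub> u\<close>.
\<close>

definition neighbors :: "('a, 'b) pre_digraph \<Rightarrow> 'a \<Rightarrow> 'a set" where
  "neighbors G v = {u. v \<rightarrow>\<^bsub>G\<^esub> u}"

definition vdegree :: "('a, 'b) pre_digraph \<Rightarrow> 'a \<Rightarrow> nat" where
  "vdegree G v = card (neighbors G v)"

text \<open>Meaningful for finite graphs with at least one vertex only.\<close>

definition max_degree :: "('a, 'b) pre_digraph \<Rightarrow> nat" where
  "max_degree G = Max (vdegree G ` verts G)"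

definition min_degree :: "('a, 'b) pre_digraph \<Rightarrow> nat" where
  "min_degree G = Min (vdegree G ` verts G)"

definition regular :: "('a, 'b) pre_digraph \<Rightarrow> bool" where
  "regular G \<longleftrightarrow> max_degree G = min_degree G"

definition triangle_free :: "('a, 'b) pre_digraph \<Rightarrow> bool" where
  "triangle_free G \<longleftrightarrow> \<not> (\<exists>u v w. u \<rightarrow>\<^bsub>G\<^esub> v \<and> v \<rightarrow>\<^bsub>G\<^esub> w \<and> w \<rightarrow>\<^bsub>G\<^esub> u)"

definition proper_coloring :: "('a, 'b) pre_digraph \<Rightarrow> ('a \<Rightarrow> 'c) \<Rightarrow> bool" where
  "proper_coloring G f \<longleftrightarrow> (\<forall>u v. u \<rightarrow>\<^bsub>G\<^esub> v \<longrightarrow> f u \<noteq> f v)"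

definition two_dynamic_coloring :: "('a, 'b) pre_digraph \<Rightarrow> ('a \<Rightarrow> 'c) \<Rightarrow> bool" where
  "two_dynamic_coloring G f \<longleftrightarrow> proper_coloring G f \<and>
     (\<forall>v\<in>verts G. card (f ` neighbors G v) \<ge> min 2 (vdegree G v))"

text \<open>
  Lists are sets of natural numbers; since \<open>G\<close> is finite, the supply of colors is irrelevant as
  long as it is infinite. The premise \<open>finite (L v)\<close> is there because \<^const>\<open>card\<close> is \<open>0\<close> on
  infinite sets, which count as lists of every size.
\<close>

definition list_assignment :: "('a, 'b) pre_digraph \<Rightarrow> nat \<Rightarrow> ('a \<Rightarrow> nat set) \<Rightarrow> bool" where
  "list_assignment G k L \<longleftrightarrow> (\<forall>v\<in>verts G. finite (L v) \<longrightarrow> card (L v) \<ge> k)"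

definition choosable :: "('a, 'b) pre_digraph \<Rightarrow> nat \<Rightarrow> bool" where
  "choosable G k \<longleftrightarrow> (\<forall>L. list_assignment G k L \<longrightarrow>
     (\<exists>f. proper_coloring G f \<and> (\<forall>v\<in>verts G. f v \<in> L v)))"

definition two_dynamic_choosable :: "('a, 'b) pre_digraph \<Rightarrow> nat \<Rightarrow> bool" where
  "two_dynamic_choosable G k \<longleftrightarrow> (\<forall>L. list_assignment G k L \<longrightarrow>
     (\<exists>f. two_dynamic_coloring G f \<and> (\<forall>v\<in>verts G. f v \<in> L v)))"

text \<open>
  For finite \<open>G\<close> both minima below exist: with lists of size at least \<open>card (verts G)\<close> one can
  give all vertices distinct colors.
\<close>

definition ch :: "('a, 'b) pre_digraph \<Rightarrow> nat" where
  "ch G = (LEAST k. choosable G k)"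

definition ch2 :: "('a, 'b) pre_digraph \<Rightarrow> nat" where
  "ch2 G = (LEAST k. k > 0 \<and> two_dynamic_choosable G k)"

end

theory Submission
  imports Defs "HOL-Library.FuncSet"
begin

text \<open>
  Let \<open>k = ch G\<close> and let \<open>m\<close> be the integer part of \<open>86 \<Delta> / \<delta>\<close>. Given lists of size
  \<open>k + m\<close>, shrink each of them to a uniformly random sublist of size \<open>k\<close>, independently. By
  the definition of \<open>k\<close> there is a proper coloring from the sublists. Nothing is known about it,
  but it can be constant on a neighborhood \<open>N(v)\<close> only if some color belongs to the sublists of
  all vertices of \<open>N(v)\<close>. A given color does so with probability at most \<open>(k / (k + m)) ^ \<delta>\<close>,
  and only the \<open>k + m\<close> colors in the list of one fixed neighbor are candidates. This event is
  determined by the sublists on \<open>N(v)\<close>, so it is independent of all but \<open>\<Delta> (\<Delta> - 1)\<close> others,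
  and the local lemma avoids all of them as soon as
  \<open>4 \<Delta> (\<Delta> - 1) (k + m) (k / (k + m)) ^ \<delta> \<le> 1\<close> (\<open>two_dynamic_choosable_if_sublists\<close>).

  The condition asks that \<open>m \<delta> / k\<close> be at least of order \<open>ln \<Delta>\<close>. Since \<open>m \<delta>\<close> is about
  \<open>86 \<Delta>\<close>, the greedy bound \<open>k \<le> \<Delta> + 1\<close> is good enough while \<open>ln \<Delta> < 18\<close>. Beyond that
  one needs \<open>k\<close> to be of order \<open>\<Delta> / ln \<Delta>\<close>. This is Johansson's theorem, which is where
  triangle-freeness enters. The constant is so generous here that a short proof suffices
  (\<open>triangle_free_choosable\<close>, with \<open>16 \<Delta> / ln \<Delta>\<close>). Take a uniformly random partial proper coloring and fix it outside \<open>N(v)\<close>. As \<open>N(v)\<close> is independent,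
  its vertices now choose independently, each uniformly among its open colors and the
  option to stay blank. Each of them hits a given color with probability at most one over its
  number of open colors, so that on average at least \<open>q exp (- \<Delta> / q)\<close> of the \<open>q\<close> colors of
  \<open>v\<close> stay open, which is far more than \<open>\<surd>\<Delta>\<close>; and the number of open colors is
  concentrated because hits of different colors are negatively correlated. Dually, if all vertices
  have more than about \<open>\<surd>\<Delta>\<close> open colors, only about \<open>\<surd>\<Delta>\<close> of them stay blank in any
  neighborhood. Hence, by the local lemma, some partial coloring leaves every vertex
  more open colors than blank neighbors, and it can be completed greedily.

  If \<open>G\<close> is regular of degree \<open>d \<ge> 22\<close>, then \<open>6 ln d + 2 \<le> d\<close> holds and the first part gives the
  second one. For \<open>2 \<le> d \<le> 21\<close> the condition of the first paragraph is a finite check with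
  \<open>m = 86\<close>, and for \<open>d \<le> 1\<close> every proper coloring is 2-dynamic.
\<close>

section \<open>A lopsided local lemma\<close>

text \<open>
  The symmetric local lemma for the uniform distribution on \<open>\<Omega>\<close>, with probabilities
  written as quotients of cardinalities. Instead of mutual independence it asks only that
  \<open>B i\<close> keeps probability at most \<open>p\<close> after conditioning on the failure of events outside
  \<open>\<Gamma> i\<close>; the colors in a random proper coloring are not independent, but they satisfy this.
  The proof shows by induction on \<open>S\<close> that \<open>B i\<close> has probability at most \<open>2 p\<close> given that no
  \<open>B j\<close> with \<open>j \<in> S\<close> occurs: adding to the conditions outside \<open>\<Gamma> i\<close> those inside
  \<open>\<Gamma> i\<close> removes, by induction, at most half of the remaining outcomes.
\<close>
lemma lopsided_local_lemma:
  fixes \<Omega> :: "'w set" and B :: "'i \<Rightarrow> 'w set" and p :: real and D :: nat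
  defines "good S \<equiv> {w\<in>\<Omega>. \<forall>j\<in>S. w \<notin> B j}"
  assumes fin: "finite \<Omega>" "finite I" and ne: "\<Omega> \<noteq> {}"
    and deg: "\<And>i. i \<in> I \<Longrightarrow> card (I \<inter> \<Gamma> i) \<le> D"
    and cond: "\<And>i S. i \<in> I \<Longrightarrow> S \<subseteq> I - insert i (\<Gamma> i) \<Longrightarrow>
                real (card (good S \<inter> B i)) \<le> p * card (good S)"
    and p: "0 \<le> p" "4 * p * real D \<le> 1" "p < 1/2"
  shows "\<exists>w\<in>\<Omega>. \<forall>i\<in>I. w \<notin> B i"
proof -
  have fg: "finite (good S)" for S using fin(1) by (simp add: good_def)
  have split: "real (card (good S)) - (\<Sum>j\<in>T. real (card (good S \<inter> B j))) \<le> card (good (S \<union> T))"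
    if "finite T" for S T
  proof -
    have "good S \<subseteq> good (S \<union> T) \<union> (\<Union>j\<in>T. good S \<inter> B j)"
      by (auto simp: good_def)
    then have "card (good S) \<le> card (good (S \<union> T) \<union> (\<Union>j\<in>T. good S \<inter> B j))"
      using fg that by (intro card_mono) auto
    also have "\<dots> \<le> card (good (S \<union> T)) + card (\<Union>j\<in>T. good S \<inter> B j)"
      by (rule card_Un_le)
    also have "\<dots> \<le> card (good (S \<union> T)) + (\<Sum>j\<in>T. card (good S \<inter> B j))"
      using card_UN_le[OF that, of "\<lambda>j. good S \<inter> B j"] by simp
    finally show ?thesis by (simp flip: of_nat_sum)
  qed
  have key: "real (card (good S \<inter> B i)) \<le> 2 * p * card (good S)" if "S \<subseteq> I" "i \<in> I" for S i
    using that
  proof (induction "card S" arbitrary: S i rule: less_induct)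
    case less
    show ?case
    proof (cases "i \<in> S")
      case True
      then have "good S \<inter> B i = {}" by (auto simp: good_def)
      then show ?thesis using p by simp
    next
      case False
      define S1 where "S1 = S \<inter> \<Gamma> i"
      define S2 where "S2 = S - \<Gamma> i"
      have fS: "finite S" using less.prems fin finite_subset by blast
      have S: "S2 \<union> S1 = S" by (auto simp: S1_def S2_def)
      have "S2 \<subseteq> I - insert i (\<Gamma> i)" using less.prems False by (auto simp: S2_def)
      then have c2: "real (card (good S2 \<inter> B i)) \<le> p * card (good S2)"
        using cond less.prems by blast
      \<comment> \<open>The events in \<open>S1\<close> have total probability at most \<open>D * 2 p \<le> 1/2\<close>.\<close>
      have half: "real (card (good S2)) \<le> 2 * card (good S)"
      proof (cases "S1 = {}")
        case True
        then show ?thesis using S by auto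
      next
        case False
        then have "S2 \<subset> S" by (auto simp: S1_def S2_def)
        then have "card S2 < card S" using fS by (simp add: psubset_card_mono)
        then have "(\<Sum>j\<in>S1. real (card (good S2 \<inter> B j))) \<le> (\<Sum>j\<in>S1. 2 * p * card (good S2))"
          using less by (intro sum_mono) (auto simp: S1_def S2_def)
        also have "\<dots> = real (card S1) * (2 * p * card (good S2))" by simp
        also have "\<dots> \<le> D * (2 * p * card (good S2))"
        proof -
          have "card S1 \<le> card (I \<inter> \<Gamma> i)"
            using less.prems fin by (intro card_mono) (auto simp: S1_def)
          then have "card S1 \<le> D" using deg less.prems by (meson order_trans)
          then show ?thesis using p by (intro mult_right_mono) auto
        qed
        also have "\<dots> = (4 * p * D) * (card (good S2) / 2)" by simp
        also have "\<dots> \<le> 1 * (card (good S2) / 2)"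
          using p by (intro mult_right_mono) auto
        finally have "(\<Sum>j\<in>S1. real (card (good S2 \<inter> B j))) \<le> card (good S2) / 2" by simp
        moreover have "finite S1" using fS by (simp add: S1_def)
        ultimately show ?thesis using split[of S1 S2] S by simp
      qed
      have "card (good S \<inter> B i) \<le> card (good S2 \<inter> B i)"
        using fg by (intro card_mono) (auto simp: good_def S2_def)
      then have "real (card (good S \<inter> B i)) \<le> p * card (good S2)" using c2 by linarith
      also have "\<dots> \<le> p * (2 * card (good S))" using half p by (intro mult_left_mono) auto
      finally show ?thesis by simp
    qed
  qed
  have "card (good S) > 0" if "finite S" "S \<subseteq> I" for S
    using that
  proof (induction S rule: finite_induct)
    case empty
    then show ?case using fin ne by (simp add: good_def card_gt_0_iff)
  next
    case (insert i S)
    have "real (card (good S)) - card (good S \<inter> B i) \<le> card (good (insert i S))"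
      using split[of "{i}" S] by simp
    moreover have "real (card (good S \<inter> B i)) \<le> 2 * p * card (good S)"
      using key insert by auto
    moreover have "2 * p * card (good S) < 1 * real (card (good S))"
      using p insert by (intro mult_strict_right_mono) auto
    ultimately show ?case by simp
  qed
  from this[OF fin(2)] have "good I \<noteq> {}" by (metis card.empty less_irrefl order_refl)
  then show ?thesis by (auto simp: good_def)
qed

text \<open>
  The law of total probability: a bound that holds conditionally on each value of \<open>r\<close> holds overall.
\<close>
lemma card_Int_le_fibres:
  fixes r :: "'w \<Rightarrow> 'k" and p :: real
  assumes "finite A"
    and "\<And>h. h \<in> A \<Longrightarrow> real (card {f\<in>A. r f = r h \<and> f \<in> B}) \<le> p * card {f\<in>A. r f = r h}"
  shows "real (card (A \<inter> B)) \<le> p * card A"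
proof -
  have sum: "real (card S) = (\<Sum>k\<in>r ` A. real (card {f\<in>S. r f = k}))" if "S \<subseteq> A" for S
  proof -
    have "finite S" using that assms(1) finite_subset by blast
    then have "(\<Sum>k\<in>r ` A. \<Sum>f\<in>{f\<in>S. r f = k}. 1::real) = (\<Sum>f\<in>S. 1)"
      using that assms(1) by (intro sum.group) auto
    then show ?thesis by simp
  qed
  have "real (card (A \<inter> B)) = (\<Sum>k\<in>r ` A. real (card {f\<in>A\<inter>B. r f = k}))" by (rule sum) auto
  also have "\<dots> \<le> (\<Sum>k\<in>r ` A. p * card {f\<in>A. r f = k})"
  proof (rule sum_mono)
    fix k assume "k \<in> r ` A"
    then obtain h where "h \<in> A" "k = r h" by blast
    moreover have "{f\<in>A\<inter>B. r f = r h} = {f\<in>A. r f = r h \<and> f \<in> B}" by auto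
    ultimately show "real (card {f\<in>A\<inter>B. r f = k}) \<le> p * card {f\<in>A. r f = k}"
      using assms(2)[of h] by simp
  qed
  also have "\<dots> = p * card A" using sum[of A] by (simp flip: sum_distrib_left)
  finally show ?thesis .
qed

text \<open>
  The form in which the local lemma is used below. Conditioning on all values outside \<open>X i\<close>
  leaves a product set, on which the values in \<open>X i\<close> are independent and the probability of \<open>B i\<close> can be
  estimated; an event \<open>B j\<close> outside \<open>\<Gamma> i\<close> does not notice the values in \<open>X i\<close>, so it is already
  decided by the condition.
\<close>
lemma local_lemma_resampling:
  fixes \<Omega> :: "('x \<Rightarrow> 'c) set" and B :: "'i \<Rightarrow> ('x \<Rightarrow> 'c) set" and p :: real and D :: nat
  assumes fin: "finite \<Omega>" "finite I" and ne: "\<Omega> \<noteq> {}"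
    and deg: "\<And>i. i \<in> I \<Longrightarrow> card (I \<inter> \<Gamma> i) \<le> D"
    and far: "\<And>i j f g. i \<in> I \<Longrightarrow> j \<in> I \<Longrightarrow> j \<notin> \<Gamma> i \<Longrightarrow> j \<noteq> i \<Longrightarrow> f \<in> \<Omega> \<Longrightarrow> g \<in> \<Omega> \<Longrightarrow>
               (\<And>x. x \<notin> X i \<Longrightarrow> f x = g x) \<Longrightarrow> f \<in> B j \<longleftrightarrow> g \<in> B j"
    and fibre: "\<And>i h. i \<in> I \<Longrightarrow> h \<in> \<Omega> \<Longrightarrow>
          {f\<in>\<Omega>. \<forall>x. x \<notin> X i \<longrightarrow> f x = h x} = (\<lambda>g. override_on h g (X i)) ` PiE (X i) (A i h)"
    and prob: "\<And>i h. i \<in> I \<Longrightarrow> h \<in> \<Omega> \<Longrightarrow>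
          real (card {g\<in>PiE (X i) (A i h). override_on h g (X i) \<in> B i}) \<le> p * card (PiE (X i) (A i h))"
    and p: "0 \<le> p" "4 * p * real D \<le> 1" "p < 1/2"
  shows "\<exists>f\<in>\<Omega>. \<forall>i\<in>I. f \<notin> B i"
proof (rule lopsided_local_lemma[OF fin ne deg _ p])
  fix i S assume i: "i \<in> I" and S: "S \<subseteq> I - insert i (\<Gamma> i)"
  define G where "G = {w\<in>\<Omega>. \<forall>j\<in>S. w \<notin> B j}"
  define r where "r f = (\<lambda>x. if x \<in> X i then undefined else f x)" for f :: "'x \<Rightarrow> 'c"
  have r: "r f = r h \<longleftrightarrow> (\<forall>x. x \<notin> X i \<longrightarrow> f x = h x)" for f h
    unfolding r_def fun_eq_iff by metis
  have "real (card (G \<inter> B i)) \<le> p * card G"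
  proof (rule card_Int_le_fibres[where r = r])
    show "finite G" using fin by (simp add: G_def)
    fix h assume h: "h \<in> G"
    then have h': "h \<in> \<Omega>" by (simp add: G_def)
    let ?P = "PiE (X i) (A i h)" and ?ov = "\<lambda>g. override_on h g (X i)"
    have sat: "f \<in> G" if "f \<in> \<Omega>" "\<forall>x. x \<notin> X i \<longrightarrow> f x = h x" for f
    proof -
      have "f \<in> B j \<longleftrightarrow> h \<in> B j" if "j \<in> S" for j
        using far[of i j f h] S i that \<open>f \<in> \<Omega>\<close> h' \<open>\<forall>x. _\<close> by blast
      then show ?thesis using h \<open>f \<in> \<Omega>\<close> by (auto simp: G_def)
    qed
    have "{f\<in>G. r f = r h} = {f\<in>\<Omega>. \<forall>x. x \<notin> X i \<longrightarrow> f x = h x}"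
      using sat unfolding r by (auto simp: G_def)
    then have 1: "{f\<in>G. r f = r h} = ?ov ` ?P"
      using fibre[OF i h'] by simp
    then have 2: "{f\<in>G. r f = r h \<and> f \<in> B i} = ?ov ` {g\<in>?P. ?ov g \<in> B i}" by auto
    have inj: "inj_on ?ov ?P"
    proof (rule inj_onI)
      fix g g' assume g: "g \<in> ?P" "g' \<in> ?P" "?ov g = ?ov g'"
      show "g = g'"
      proof (rule PiE_ext[OF g(1,2)])
        fix x assume "x \<in> X i"
        then show "g x = g' x" using fun_cong[OF g(3), of x] by simp
      qed
    qed
    have "card {f\<in>G. r f = r h \<and> f \<in> B i} = card {g\<in>?P. ?ov g \<in> B i}"
      unfolding 2 by (rule card_image) (use inj in \<open>auto intro: inj_on_subset\<close>)
    moreover have "card {f\<in>G. r f = r h} = card ?P" unfolding 1 by (rule card_image[OF inj])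
    ultimately show "real (card {f\<in>G. r f = r h \<and> f \<in> B i}) \<le> p * card {f\<in>G. r f = r h}"
      using prob[OF i h'] by simp
  qed
  then show "real (card ({w\<in>\<Omega>. \<forall>j\<in>S. w \<notin> B j} \<inter> B i)) \<le> p * card {w\<in>\<Omega>. \<forall>j\<in>S. w \<notin> B j}"
    by (simp add: G_def)
qed

section \<open>Independent random colors and blanks\<close>

lemma sum_PiE_insert:
  fixes F :: "('x \<Rightarrow> 'c) \<Rightarrow> real"
  assumes "x \<notin> X"
  shows "(\<Sum>g\<in>PiE (insert x X) A. F g) = (\<Sum>o'\<in>A x. \<Sum>g\<in>PiE X A. F (g(x := o')))"
proof -
  have "(\<Sum>g\<in>PiE (insert x X) A. F g) = (\<Sum>(y, g)\<in>A x \<times> PiE X A. F (g(x := y)))"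
    unfolding PiE_insert_eq using inj_combinator[OF assms, of A]
    by (subst sum.reindex) (auto simp: case_prod_unfold)
  then show ?thesis by (simp add: sum.cartesian_product)
qed

lemma one_plus_sum_le_prod:
  fixes z :: "'c \<Rightarrow> real"
  assumes "finite T" "\<And>c. c \<in> T \<Longrightarrow> 0 \<le> z c"
  shows "1 + (\<Sum>c\<in>T. z c) \<le> (\<Prod>c\<in>T. 1 + z c)"
  using assms
proof (induction T rule: finite_induct)
  case (insert c T)
  then have "1 + sum z T \<le> (\<Prod>c\<in>T. 1 + z c)" by simp
  moreover have "0 \<le> sum z T" using insert by (simp add: sum_nonneg)
  ultimately have "(1 + z c) * (1 + sum z T) \<le> (1 + z c) * (\<Prod>c\<in>T. 1 + z c)"
    using insert by (intro mult_left_mono) auto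
  moreover have "1 + (z c + sum z T) \<le> (1 + z c) * (1 + sum z T)"
    using insert \<open>0 \<le> sum z T\<close> by (simp add: algebra_simps)
  ultimately show ?case using insert by simp
qed simp

text \<open>
  Each \<open>u\<close> in \<open>X\<close> either stays blank (\<open>None\<close>) or takes a color from \<open>A u\<close>. The following
  lemmas consider a uniformly random element of this set, so that \<open>u\<close> takes any given option with
  probability \<open>1 / (card (A u) + 1)\<close>.
\<close>
abbreviation blank_or_color :: "'x set \<Rightarrow> ('x \<Rightarrow> 'c set) \<Rightarrow> ('x \<Rightarrow> 'c option) set" where
  "blank_or_color X A \<equiv> PiE X (\<lambda>u. insert None (Some ` A u))"

text \<open>
  The probability that no element of \<open>X\<close> takes the color \<open>c\<close>.
\<close>
definition miss_prob :: "'x set \<Rightarrow> ('x \<Rightarrow> 'c set) \<Rightarrow> 'c \<Rightarrow> real" where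
  "miss_prob X A c = (\<Prod>u\<in>X. if c \<in> A u then real (card (A u)) / (real (card (A u)) + 1) else 1)"

lemma miss_prob_bounds: "0 \<le> miss_prob X A c" "miss_prob X A c \<le> 1"
  unfolding miss_prob_def by (auto intro!: prod_nonneg prod_le_1 simp: divide_simps)

text \<open>
  Divided by the number of choices, the left side is the expectation of a product over the colors
  of \<open>T\<close>, with factor \<open>1 - y c\<close> if \<open>c\<close> is missed and \<open>1\<close> if it is taken, and the right side is the
  product of the expectations of the factors. The inequality holds because one element
  takes at most one color. In the induction, the options of a new element \<open>x\<close> contribute,
  with \<open>n = card (A x)\<close>, a factor \<open>1 + \<Sum> z c / (n + 1)\<close>, whereas the product of expectations
  gains the factors \<open>1 + z c / (n + 1)\<close>. Arbitrary weights \<open>y\<close> are needed since taking \<open>a\<close> amounts to setting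
  \<open>y a\<close> to \<open>0\<close>; they stay below \<open>1\<close> so that \<open>z\<close> is well defined.
\<close>
lemma negative_correlation_missed_colors:
  fixes A :: "'x \<Rightarrow> 'c set" and y :: "'c \<Rightarrow> real"
  assumes "finite X" "finite T" "\<And>u. u \<in> X \<Longrightarrow> finite (A u)" "\<And>c. 0 \<le> y c \<and> y c < 1"
  shows "(\<Sum>g\<in>blank_or_color X A. \<Prod>c\<in>T. 1 - (if Some c \<in> g ` X then 0 else y c))
          \<le> (\<Prod>u\<in>X. real (card (A u) + 1)) * (\<Prod>c\<in>T. 1 - y c * miss_prob X A c)"
  using assms
proof (induction X arbitrary: y rule: finite_induct)
  case empty
  then show ?case by (simp add: miss_prob_def)
next
  case (insert x X)
  let ?K = "\<Prod>u\<in>X. real (card (A u) + 1)"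
  let ?m = "miss_prob X A"
  define R where "R y = (\<Prod>c\<in>T. 1 - y c * ?m c)" for y :: "'c \<Rightarrow> real"
  define W where "W y = (\<Sum>g\<in>blank_or_color X A. \<Prod>c\<in>T. 1 - (if Some c \<in> g ` X then 0 else y c))"
    for y :: "'c \<Rightarrow> real"
  have finA: "finite (A x)" using insert by simp
  have IH: "W y' \<le> ?K * R y'" if "\<And>c. 0 \<le> y' c \<and> y' c < 1" for y'
    using insert.IH[of y'] insert.prems that by (simp add: W_def R_def)
  have im: "(g(x := o')) ` insert x X = insert o' (g ` X)" for g :: "'x \<Rightarrow> 'c option" and o'
    using insert.hyps by auto
  have pos: "0 < 1 - y c * ?m c" for c
  proof -
    have "y c * ?m c \<le> y c * 1"
      using insert.prems(3)[of c] miss_prob_bounds[of X A c] by (intro mult_left_mono) auto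
    then show ?thesis using insert.prems(3)[of c] by linarith
  qed
  define z where "z c = y c * ?m c / (1 - y c * ?m c)" for c
  have z0: "0 \<le> z c" for c
    using pos[of c] insert.prems(3)[of c] miss_prob_bounds(1)[of X A c] by (simp add: z_def)
  have z1: "(1 - y c * ?m c) * (1 + z c) = 1" for c
    using pos[of c] by (simp add: z_def field_simps)
  \<comment> \<open>Dropping the factor of \<open>a\<close> from \<open>R y\<close> means multiplying by \<open>1 + z a\<close>.\<close>
  have Ra: "R (y(a := 0)) = R y * (1 + (if a \<in> T then z a else 0))" for a
  proof (cases "a \<in> T")
    case True
    have "R (y(a := 0)) = (\<Prod>c\<in>T - {a}. 1 - y c * ?m c)"
      unfolding R_def using True insert.prems(1) by (subst prod.remove[of T a]) auto
    moreover have "R y = (1 - y a * ?m a) * (\<Prod>c\<in>T - {a}. 1 - y c * ?m c)"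
      unfolding R_def using True insert.prems(1) by (subst prod.remove[of T a]) auto
    ultimately have "R y * (1 + z a) = R (y(a := 0)) * ((1 - y a * ?m a) * (1 + z a))" by (simp add: mult_ac)
    then show ?thesis using z1[of a] True by simp
  next
    case False
    then show ?thesis unfolding R_def by (auto intro!: prod.cong)
  qed
  have R0: "0 \<le> R y" unfolding R_def by (intro prod_nonneg ballI less_imp_le pos)
  let ?n = "real (card (A x))"
  have "(\<Sum>g\<in>blank_or_color (insert x X) A. \<Prod>c\<in>T. 1 - (if Some c \<in> g ` insert x X then 0 else y c))
      = (\<Sum>o'\<in>insert None (Some ` A x). \<Sum>g\<in>blank_or_color X A.
           \<Prod>c\<in>T. 1 - (if Some c \<in> insert o' (g ` X) then 0 else y c))"
    by (subst sum_PiE_insert[OF insert.hyps(2)]) (simp only: im)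
  also have "\<dots> = W y + (\<Sum>a\<in>A x. W (y(a := 0)))"
  proof -
    have "(\<Sum>g\<in>blank_or_color X A. \<Prod>c\<in>T. 1 - (if Some c \<in> insert (Some a) (g ` X) then 0 else y c))
       = W (y(a := 0))" for a
      unfolding W_def by (intro sum.cong prod.cong) auto
    then show ?thesis using finA by (simp add: sum.reindex W_def image_iff)
  qed
  also have "\<dots> \<le> ?K * R y + (\<Sum>a\<in>A x. ?K * R (y(a := 0)))"
    using insert.prems(3) by (intro add_mono sum_mono IH) auto
  also have "\<dots> = ?K * (R y * (1 + ?n + (\<Sum>a\<in>A x. if a \<in> T then z a else 0)))"
  proof -
    have "(\<Sum>a\<in>A x. R (y(a := 0))) = R y * (?n + (\<Sum>a\<in>A x. if a \<in> T then z a else 0))"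
      unfolding Ra by (simp add: sum.distrib flip: sum_distrib_left)
    then show ?thesis by (simp add: distrib_left flip: sum_distrib_left)
  qed
  also have "(\<Sum>a\<in>A x. if a \<in> T then z a else 0) = (\<Sum>c\<in>T. if c \<in> A x then z c else 0)"
    using finA insert.prems(1) by (simp add: sum.If_cases Int_commute)
  also have "1 + ?n + \<dots> = (?n + 1) * (1 + (\<Sum>c\<in>T. (if c \<in> A x then z c else 0) / (?n + 1)))"
    by (simp add: field_simps flip: sum_divide_distrib)
  also have "?K * (R y * \<dots>) \<le> ?K * (R y * ((?n + 1) * (\<Prod>c\<in>T. 1 + (if c \<in> A x then z c else 0) / (?n + 1))))"
    using insert.prems(1) R0 z0
    by (intro mult_left_mono one_plus_sum_le_prod) (auto intro!: prod_nonneg)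
  also have "\<dots> = (?n + 1) * ?K * (\<Prod>c\<in>T. (1 - y c * ?m c) * (1 + (if c \<in> A x then z c else 0) / (?n + 1)))"
    unfolding R_def by (simp add: prod.distrib mult_ac)
  also have "(\<Prod>c\<in>T. (1 - y c * ?m c) * (1 + (if c \<in> A x then z c else 0) / (?n + 1)))
     = (\<Prod>c\<in>T. 1 - y c * miss_prob (insert x X) A c)"
  proof (rule prod.cong[OF refl])
    fix c assume "c \<in> T"
    show "(1 - y c * ?m c) * (1 + (if c \<in> A x then z c else 0) / (?n + 1))
       = 1 - y c * miss_prob (insert x X) A c"
    proof (cases "c \<in> A x")
      case True
      have "(1 - y c * ?m c) * z c = y c * ?m c" using pos[of c] by (simp add: z_def)
      then have "(1 - y c * ?m c) * (1 + z c / (?n + 1)) = 1 - y c * ?m c + y c * ?m c / (?n + 1)"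
        by (simp add: distrib_left)
      also have "\<dots> = 1 - y c * (?n / (?n + 1) * ?m c)"
        by (simp add: field_simps)
      finally show ?thesis using True insert.hyps by (simp add: miss_prob_def)
    next
      case False
      then show ?thesis using insert.hyps by (simp add: miss_prob_def)
    qed
  qed
  also have "(?n + 1) * ?K = (\<Prod>u\<in>insert x X. real (card (A u) + 1))"
    using insert.hyps by (simp add: algebra_simps)
  finally show ?case .
qed

lemma card_blank_or_color:
  assumes "finite X" "\<And>u. u \<in> X \<Longrightarrow> finite (A u)"
  shows "real (card (blank_or_color X A)) = (\<Prod>u\<in>X. real (card (A u) + 1))"
  using assms by (simp add: card_PiE card_insert_if card_image image_iff of_nat_prod[symmetric] del: of_nat_prod of_nat_add of_nat_Suc)

text \<open>
  A color \<open>c\<close> is missed with probability at least \<open>exp (- s c)\<close>, where \<open>s c\<close> is the sum of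
  \<open>1 / card (A u)\<close> over all \<open>u\<close> with \<open>c \<in> A u\<close>. Each \<open>u\<close> contributes at most \<open>1\<close> to the sum of
  all \<open>s c\<close>, whose average over \<open>T\<close> is therefore at most \<open>d / card T\<close>, and \<open>exp\<close> is convex.
\<close>
lemma sum_miss_prob_ge:
  fixes A :: "'x \<Rightarrow> 'c set"
  assumes "finite X" "finite T" "T \<noteq> {}" "\<And>u. u \<in> X \<Longrightarrow> finite (A u)" "real (card X) \<le> d"
  shows "card T * exp (- d / card T) \<le> (\<Sum>c\<in>T. miss_prob X A c)"
proof -
  define s where "s c = (\<Sum>u\<in>X. if c \<in> A u then 1 / real (card (A u)) else 0)" for c
  let ?q = "real (card T)"
  have q: "?q > 0" using assms by (simp add: card_gt_0_iff)
  have exp_s: "exp (- s c) \<le> miss_prob X A c" for c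
  proof -
    have "exp (- s c) = (\<Prod>u\<in>X. exp (- (if c \<in> A u then 1 / real (card (A u)) else 0)))"
      unfolding s_def using assms(1) by (simp add: exp_sum flip: sum_negf)
    also have "\<dots> \<le> miss_prob X A c"
      unfolding miss_prob_def
    proof (rule prod_mono, safe)
      fix u assume u: "u \<in> X"
      show "exp (- (if c \<in> A u then 1 / real (card (A u)) else 0))
         \<le> (if c \<in> A u then real (card (A u)) / (real (card (A u)) + 1) else 1)"
      proof (cases "c \<in> A u")
        case True
        then have n: "real (card (A u)) > 0" using assms(4)[OF u] by (auto simp: card_gt_0_iff)
        have "1 + 1 / real (card (A u)) \<le> exp (1 / real (card (A u)))" by (rule exp_ge_add_one_self)
        then have "exp (- (1 / real (card (A u)))) \<le> 1 / (1 + 1 / real (card (A u)))"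
          using n by (simp add: exp_minus inverse_eq_divide frac_le add_pos_pos)
        also have "\<dots> = real (card (A u)) / (real (card (A u)) + 1)" using n by (simp add: field_simps)
        finally show ?thesis using True by simp
      qed simp
    qed simp
    finally show ?thesis .
  qed
  have "(\<Sum>c\<in>T. s c) = (\<Sum>u\<in>X. \<Sum>c\<in>T. if c \<in> A u then 1 / real (card (A u)) else 0)"
    unfolding s_def by (rule sum.swap)
  also have "\<dots> \<le> (\<Sum>u\<in>X. 1)"
  proof (rule sum_mono)
    fix u assume "u \<in> X"
    then have f: "finite (A u)" using assms by simp
    have "card (T \<inter> A u) \<le> card (A u)" using f by (intro card_mono) auto
    then have "real (card (T \<inter> A u)) / card (A u) \<le> 1" by (simp add: divide_simps)
    then show "(\<Sum>c\<in>T. if c \<in> A u then 1 / real (card (A u)) else 0) \<le> 1"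
      using assms(2) by (simp add: sum.If_cases)
  qed
  finally have s_le: "(\<Sum>c\<in>T. s c) \<le> d" using assms(5) by simp
  \<comment> \<open>The tangent of \<open>exp\<close> at \<open>- d / q\<close> replaces Jensen's inequality.\<close>
  let ?m = "d / ?q"
  have "?q * exp (- ?m) \<le> exp (- ?m) * (?q + ?q * ?m - (\<Sum>c\<in>T. s c))"
    using s_le q by (simp add: algebra_simps)
  also have "?q + ?q * ?m - (\<Sum>c\<in>T. s c) = (\<Sum>c\<in>T. 1 + (?m - s c))"
    by (simp add: sum.distrib sum_subtractf)
  also have "exp (- ?m) * \<dots> = (\<Sum>c\<in>T. exp (- ?m) * (1 + (?m - s c)))"
    by (rule sum_distrib_left)
  also have "\<dots> \<le> (\<Sum>c\<in>T. exp (- ?m) * exp (?m - s c))"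
    by (intro sum_mono mult_left_mono exp_ge_add_one_self) auto
  also have "\<dots> = (\<Sum>c\<in>T. exp (- s c))" by (simp flip: exp_add)
  also have "\<dots> \<le> (\<Sum>c\<in>T. miss_prob X A c)" by (intro sum_mono exp_s)
  finally show ?thesis by simp
qed

text \<open>
  Markov's inequality for \<open>(1/2) ^ M\<close>, where \<open>M\<close> is the number of missed colors: the expectation is
  controlled by negative correlation with \<open>y = 1/2\<close>.
\<close>
lemma few_missed_colors_unlikely:
  fixes A :: "'x \<Rightarrow> 'c set"
  assumes X: "finite X" "\<And>u. u \<in> X \<Longrightarrow> finite (A u)" "real (card X) \<le> d"
    and T: "finite T" "T \<noteq> {}"
  shows "real (card {g\<in>blank_or_color X A. card {c\<in>T. Some c \<notin> g ` X} < l})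
           \<le> 2 ^ l * exp (- (card T * exp (- d / card T)) / 2) * card (blank_or_color X A)"
proof -
  let ?P = "blank_or_color X A"
  define w where "w g = (\<Prod>c\<in>T. 1 - (if Some c \<in> g ` X then 0 else 1/2 :: real))" for g
  have w: "w g = (1/2) ^ card {c\<in>T. Some c \<notin> g ` X}" for g
  proof -
    have "w g = (\<Prod>c\<in>T. if Some c \<in> g ` X then 1 else 1/2)"
      unfolding w_def by (intro prod.cong) auto
    also have "\<dots> = (1/2) ^ card {c\<in>T. Some c \<notin> g ` X}"
      using T by (simp add: prod.If_cases Int_def)
    finally show ?thesis .
  qed
  have fP: "finite ?P" using X by (intro finite_PiE) auto
  let ?S = "{g\<in>?P. card {c\<in>T. Some c \<notin> g ` X} < l}"
  have "card ?S * (1/2) ^ l = (\<Sum>g\<in>?S. (1/2 :: real) ^ l)" by simp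
  also have "\<dots> \<le> (\<Sum>g\<in>?S. w g)" unfolding w by (intro sum_mono power_decreasing) auto
  also have "\<dots> \<le> (\<Sum>g\<in>?P. w g)" using fP by (intro sum_mono2) (auto simp: w)
  also have "\<dots> \<le> (\<Prod>u\<in>X. real (card (A u) + 1)) * (\<Prod>c\<in>T. 1 - 1/2 * miss_prob X A c)"
    unfolding w_def using X T by (intro negative_correlation_missed_colors) auto
  also have "\<dots> = card ?P * (\<Prod>c\<in>T. 1 - 1/2 * miss_prob X A c)"
    by (simp only: card_blank_or_color[OF X(1,2)])
  also have "\<dots> \<le> card ?P * exp (- (card T * exp (- d / card T)) / 2)"
  proof (rule mult_left_mono)
    have "(\<Prod>c\<in>T. 1 - 1/2 * miss_prob X A c) \<le> (\<Prod>c\<in>T. exp (- (1/2 * miss_prob X A c)))"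
    proof (rule prod_mono, safe)
      fix c
      show "0 \<le> 1 - 1/2 * miss_prob X A c" using miss_prob_bounds(2)[of X A c] by simp
      show "1 - 1/2 * miss_prob X A c \<le> exp (- (1/2 * miss_prob X A c))"
        using exp_ge_add_one_self[of "- (1/2 * miss_prob X A c)"] by simp
    qed
    also have "\<dots> = exp (- (\<Sum>c\<in>T. miss_prob X A c) / 2)"
      using T by (simp add: sum_divide_distrib sum_negf flip: exp_sum)
    also have "\<dots> \<le> exp (- (card T * exp (- d / card T)) / 2)"
      using sum_miss_prob_ge[OF X(1) T X(2) X(3)] by simp
    finally show "(\<Prod>c\<in>T. 1 - 1/2 * miss_prob X A c) \<le> exp (- (card T * exp (- d / card T)) / 2)" .
  qed simp
  finally show ?thesis by (simp add: field_simps)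
qed

text \<open>
  Markov's inequality for \<open>2 ^ Z\<close>, where \<open>Z\<close> counts the blanks among the elements with at least \<open>l\<close>
  colors. Those are blank independently and with probability at most \<open>1 / l\<close>; an element
  with fewer colors may be blank almost surely and must not be counted.
\<close>
lemma many_blanks_unlikely:
  fixes A :: "'x \<Rightarrow> 'c set"
  assumes X: "finite X" "\<And>u. u \<in> X \<Longrightarrow> finite (A u)" "real (card X) \<le> d" and l: "l > 0"
  shows "real (card {g\<in>blank_or_color X A. l \<le> card {u\<in>X. g u = None \<and> l \<le> card (A u)}})
           \<le> exp (d / l) / 2 ^ l * card (blank_or_color X A)"
proof -
  let ?P = "blank_or_color X A"
  define w where "w g = (\<Prod>u\<in>X. if g u = None \<and> l \<le> card (A u) then 2 else 1 :: real)"
    for g :: "'x \<Rightarrow> 'c option"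
  have w: "w g = 2 ^ card {u\<in>X. g u = None \<and> l \<le> card (A u)}" for g
    unfolding w_def using X by (simp add: prod.If_cases Int_def)
  have fP: "finite ?P" using X by (intro finite_PiE) auto
  let ?S = "{g\<in>?P. l \<le> card {u\<in>X. g u = None \<and> l \<le> card (A u)}}"
  have "card ?S * 2 ^ l = (\<Sum>g\<in>?S. (2 :: real) ^ l)" by simp
  also have "\<dots> \<le> (\<Sum>g\<in>?S. w g)" unfolding w by (intro sum_mono power_increasing) auto
  also have "\<dots> \<le> (\<Sum>g\<in>?P. w g)" using fP by (intro sum_mono2) (auto simp: w)
  also have "\<dots> = (\<Prod>u\<in>X. \<Sum>o'\<in>insert None (Some ` A u). if o' = None \<and> l \<le> card (A u) then 2 else 1)"
    unfolding w_def using X by (subst prod_sum_PiE) auto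
  also have "\<dots> \<le> (\<Prod>u\<in>X. real (card (A u) + 1) * exp (1 / l))"
  proof (rule prod_mono, safe)
    fix u assume u: "u \<in> X"
    have "(\<Sum>o'\<in>insert None (Some ` A u). if o' = None \<and> l \<le> card (A u) then 2 else 1 :: real)
       = card (A u) + 1 + (if l \<le> card (A u) then 1 else 0)"
      using X(2)[OF u] by (simp add: sum.reindex image_iff)
    also have "\<dots> \<le> real (card (A u) + 1) * (1 + 1 / l)"
      using l by (simp add: field_simps)
    also have "\<dots> \<le> real (card (A u) + 1) * exp (1 / l)"
      by (intro mult_left_mono exp_ge_add_one_self) auto
    finally show "(\<Sum>o'\<in>insert None (Some ` A u). if o' = None \<and> l \<le> card (A u) then 2 else 1 :: real)
       \<le> real (card (A u) + 1) * exp (1 / l)" .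
  qed (auto intro: sum_nonneg)
  also have "\<dots> = card ?P * exp (1 / l) ^ card X"
    by (simp only: prod.distrib prod_constant card_blank_or_color[OF X(1,2)])
  also have "\<dots> \<le> card ?P * exp (d / l)"
    using X(3) by (intro mult_left_mono) (auto simp: divide_right_mono simp flip: exp_of_nat_mult)
  finally show ?thesis by (simp add: field_simps)
qed

section \<open>Neighborhoods and lists\<close>

context graph
begin

lemma neighbors_subset: "neighbors G v \<subseteq> verts G"
  unfolding neighbors_def by (auto intro: adj_in_verts)

lemma finite_neighbors [simp]: "finite (neighbors G v)"
  using neighbors_subset finite_verts by (rule finite_subset)

lemma neighbors_sym: "u \<in> neighbors G v \<longleftrightarrow> v \<in> neighbors G u"
  unfolding neighbors_def using arcs_ends_symmetric[OF sym_arcs] by auto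

lemma neighbor_sym: "u \<in> neighbors G v \<Longrightarrow> v \<in> neighbors G u"
  using neighbors_sym by simp

lemma neighbor_in_verts: "u \<in> neighbors G v \<Longrightarrow> u \<in> verts G \<and> v \<in> verts G"
  using neighbors_subset neighbor_sym by blast

lemma not_neighbor_self [simp]: "v \<notin> neighbors G v"
  unfolding neighbors_def using adj_not_same by auto

lemma proper_coloring_iff: "proper_coloring G f \<longleftrightarrow> (\<forall>v. \<forall>u\<in>neighbors G v. f u \<noteq> f v)"
  unfolding proper_coloring_def neighbors_def mem_Collect_eq Ball_def by metis

lemma disjoint_neighbors:
  assumes "triangle_free G" "u \<in> neighbors G v"
  shows "neighbors G u \<inter> neighbors G v = {}"
  using assms neighbors_sym unfolding triangle_free_def neighbors_def by blast

lemma exact_sublists: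
  assumes "list_assignment G k L"
  obtains L' where "\<And>v. v \<in> verts G \<Longrightarrow> L' v \<subseteq> L v \<and> finite (L' v) \<and> card (L' v) = k"
proof -
  have "\<exists>S. S \<subseteq> L v \<and> finite S \<and> card S = k" if "v \<in> verts G" for v
  proof (cases "finite (L v)")
    case True
    then show ?thesis
      using assms that obtain_subset_with_card_n[of k "L v"] unfolding list_assignment_def by metis
  next
    case False
    then show ?thesis using infinite_arbitrarily_large by blast
  qed
  then show ?thesis using that by metis
qed

end

section \<open>Random sublists without a common color\<close>

lemma card_sublists_containing:
  assumes "finite L" "card L = n" "n > 0"
  shows "real (card {S. S \<subseteq> L \<and> card S = k \<and> c \<in> S}) \<le> real k / real n * card {S. S \<subseteq> L \<and> card S = k}"
proof (cases "c \<in> L \<and> k > 0")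
  case True
  have "{S. S \<subseteq> L \<and> card S = k \<and> c \<in> S} \<subseteq> insert c ` {S. S \<subseteq> L - {c} \<and> card S = k - 1}"
  proof
    fix S assume S: "S \<in> {S. S \<subseteq> L \<and> card S = k \<and> c \<in> S}"
    then have "finite S" using assms finite_subset by blast
    then have "S - {c} \<in> {S. S \<subseteq> L - {c} \<and> card S = k - 1}" using S by auto
    moreover have "S = insert c (S - {c})" using S by auto
    ultimately show "S \<in> insert c ` {S. S \<subseteq> L - {c} \<and> card S = k - 1}" by blast
  qed
  then have "card {S. S \<subseteq> L \<and> card S = k \<and> c \<in> S} \<le> card {S. S \<subseteq> L - {c} \<and> card S = k - 1}"
    using assms(1) by (rule_tac surj_card_le) auto
  also have "\<dots> = (n - 1) choose (k - 1)"
    using True assms by (subst n_subsets) auto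
  finally have 1: "card {S. S \<subseteq> L \<and> card S = k \<and> c \<in> S} \<le> (n - 1) choose (k - 1)" .
  have "n * ((n - 1) choose (k - 1)) = k * (n choose k)"
    using times_binomial_minus1_eq[of k n] True by simp
  then have "real n * ((n - 1) choose (k - 1)) = real k * (n choose k)"
    by (simp only: of_nat_mult [symmetric])
  then have "real ((n - 1) choose (k - 1)) = real k / real n * (n choose k)"
    using assms(3) by (simp add: field_simps)
  then show ?thesis using 1 assms by (simp add: n_subsets)
next
  case False
  then have "{S. S \<subseteq> L \<and> card S = k \<and> c \<in> S} = {}"
    using assms(1) by (auto dest: finite_subset)
  then show ?thesis by (simp only: card.empty) simp
qed

text \<open>
  A common color is one of the \<open>n\<close> colors in the list of a fixed \<open>u0\<close>, and a given color lies in a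
  random \<open>k\<close>-sublist of an \<open>n\<close>-element list with probability at most \<open>k / n\<close>.
\<close>
lemma common_color_unlikely:
  fixes L :: "'x \<Rightarrow> 'c set" and k n :: nat
  assumes X: "finite X" "X \<noteq> {}" and n: "n > 0"
    and L: "\<And>u. u \<in> X \<Longrightarrow> finite (L u) \<and> card (L u) = n"
  defines "P \<equiv> PiE X (\<lambda>u. {S. S \<subseteq> L u \<and> card S = k})"
  shows "real (card {g\<in>P. \<exists>c. \<forall>u\<in>X. c \<in> g u}) \<le> n * (real k / real n) ^ card X * card P"
proof -
  obtain u0 where u0: "u0 \<in> X" using X by blast
  let ?Q = "\<lambda>c. PiE X (\<lambda>u. {S. S \<subseteq> L u \<and> card S = k \<and> c \<in> S})"
  have fin: "finite (?Q c)" for c using X L by (intro finite_PiE) auto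
  have "{g\<in>P. \<exists>c. \<forall>u\<in>X. c \<in> g u} \<subseteq> (\<Union>c\<in>L u0. ?Q c)"
  proof
    fix g assume "g \<in> {g\<in>P. \<exists>c. \<forall>u\<in>X. c \<in> g u}"
    then obtain c where g: "g \<in> P" and c: "\<And>u. u \<in> X \<Longrightarrow> c \<in> g u" by blast
    have "g \<in> ?Q c" using g c by (simp add: P_def PiE_iff)
    moreover have "g u0 \<subseteq> L u0" using g u0 by (simp add: P_def PiE_iff)
    then have "c \<in> L u0" using c[OF u0] by blast
    ultimately show "g \<in> (\<Union>c\<in>L u0. ?Q c)" by blast
  qed
  then have "card {g\<in>P. \<exists>c. \<forall>u\<in>X. c \<in> g u} \<le> card (\<Union>c\<in>L u0. ?Q c)"
    using fin L[OF u0] by (intro card_mono) auto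
  also have "\<dots> \<le> (\<Sum>c\<in>L u0. card (?Q c))" using L[OF u0] by (intro card_UN_le) auto
  finally have "real (card {g\<in>P. \<exists>c. \<forall>u\<in>X. c \<in> g u}) \<le> (\<Sum>c\<in>L u0. real (card (?Q c)))"
    by (simp flip: of_nat_sum)
  also have "\<dots> \<le> (\<Sum>c\<in>L u0. (real k / real n) ^ card X * card P)"
  proof (rule sum_mono)
    fix c
    have "real (card (?Q c)) = (\<Prod>u\<in>X. real (card {S. S \<subseteq> L u \<and> card S = k \<and> c \<in> S}))"
      using X by (simp add: card_PiE)
    also have "\<dots> \<le> (\<Prod>u\<in>X. real k / real n * card {S. S \<subseteq> L u \<and> card S = k})"
      using L n by (intro prod_mono conjI card_sublists_containing) auto
    also have "\<dots> = (real k / real n) ^ card X * card P"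
      using X by (simp only: P_def card_PiE prod.distrib prod_constant of_nat_prod)
    finally show "real (card (?Q c)) \<le> (real k / real n) ^ card X * card P" .
  qed
  also have "\<dots> = n * (real k / real n) ^ card X * card P" using L[OF u0] by simp
  finally show ?thesis .
qed

lemma PiE_fibre_eq_override:
  assumes "X \<subseteq> V" "h \<in> PiE V A"
  shows "{f\<in>PiE V A. \<forall>x. x \<notin> X \<longrightarrow> f x = h x} = (\<lambda>g. override_on h g X) ` PiE X A"
proof (intro equalityI subsetI)
  fix f assume f: "f \<in> {f\<in>PiE V A. \<forall>x. x \<notin> X \<longrightarrow> f x = h x}"
  then have "f = override_on h (restrict f X) X" "restrict f X \<in> PiE X A"
    using assms by (auto simp: override_on_def fun_eq_iff PiE_iff)
  then show "f \<in> (\<lambda>g. override_on h g X) ` PiE X A" by blast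
next
  fix f assume "f \<in> (\<lambda>g. override_on h g X) ` PiE X A"
  then show "f \<in> {f\<in>PiE V A. \<forall>x. x \<notin> X \<longrightarrow> f x = h x}"
    using assms by (auto simp: override_on_def PiE_iff extensional_def)
qed

text \<open>
  The event \<open>B v\<close> says that the sublists on the neighborhood of \<open>v\<close> share a color. It involves only the
  sublists on that neighborhood, so \<open>\<Gamma> v\<close> consists of the other vertices having a neighbor in
  common with \<open>v\<close>, of which there are at most \<open>\<Delta> (\<Delta> - 1)\<close>. If no \<open>B v\<close> occurs, every
  proper coloring from the sublists is 2-dynamic.
\<close>
lemma (in graph) two_dynamic_choosable_if_sublists:
  fixes k m \<delta> \<Delta> :: nat
  assumes ch: "choosable G k" and deg: "\<And>v. v \<in> verts G \<Longrightarrow> \<delta> \<le> vdegree G v \<and> vdegree G v \<le> \<Delta>"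
    and pos: "0 < \<delta>" "0 < k + m"
    and p: "4 * ((k + m) * (k / (k + m)) ^ \<delta>) * real (\<Delta> * (\<Delta> - 1)) \<le> 1"
      "(k + m) * (k / (k + m)) ^ \<delta> < 1/2"
  shows "two_dynamic_choosable G (k + m)"
  unfolding two_dynamic_choosable_def
proof (intro allI impI)
  fix L0 assume "list_assignment G (k + m) L0"
  then obtain L where L: "\<And>v. v \<in> verts G \<Longrightarrow> L v \<subseteq> L0 v \<and> finite (L v) \<and> card (L v) = k + m"
    by (rule exact_sublists) blast
  let ?N = "neighbors G"
  define A where "A u = {S. S \<subseteq> L u \<and> card S = k}" for u
  define \<Gamma> where "\<Gamma> v = (\<Union>u\<in>?N v. ?N u - {v})" for v
  define B where "B v = {f :: 'a \<Rightarrow> nat set. \<exists>c. \<forall>u\<in>?N v. c \<in> f u}" for v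
  have "\<exists>f\<in>PiE (verts G) A. \<forall>v\<in>verts G. f \<notin> B v"
  proof (rule local_lemma_resampling[where X = ?N and A = "\<lambda>_ _. A"
        and \<Gamma> = \<Gamma> and D = "\<Delta> * (\<Delta> - 1)" and p = "(k + m) * (k / (k + m)) ^ \<delta>"])
    show "finite (PiE (verts G) A)" using L by (intro finite_PiE) (auto simp: A_def)
    have "A u \<noteq> {}" if "u \<in> verts G" for u
      using L[OF that] obtain_subset_with_card_n[of k "L u"] unfolding A_def by auto
    then show "PiE (verts G) A \<noteq> {}" by (simp add: PiE_eq_empty_iff)
    show "card (verts G \<inter> \<Gamma> v) \<le> \<Delta> * (\<Delta> - 1)" if v: "v \<in> verts G" for v
    proof -
      have "card (verts G \<inter> \<Gamma> v) \<le> card (\<Gamma> v)" by (intro card_mono) (auto simp: \<Gamma>_def)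
      also have "\<dots> \<le> (\<Sum>u\<in>?N v. card (?N u - {v}))" unfolding \<Gamma>_def by (rule card_UN_le) simp
      also have "\<dots> \<le> (\<Sum>u\<in>?N v. \<Delta> - 1)"
      proof (rule sum_mono)
        fix u assume "u \<in> ?N v"
        then have "u \<in> verts G" "v \<in> ?N u" using neighbors_subset neighbors_sym by auto
        then show "card (?N u - {v}) \<le> \<Delta> - 1"
          using deg[of u] by (simp add: vdegree_def diff_le_mono)
      qed
      also have "\<dots> \<le> \<Delta> * (\<Delta> - 1)" using deg[OF v] by (simp add: vdegree_def)
      finally show ?thesis .
    qed
    show "f \<in> B j \<longleftrightarrow> g \<in> B j"
      if "j \<notin> \<Gamma> i" "j \<noteq> i" "\<And>x. x \<notin> ?N i \<Longrightarrow> f x = g x" for i j f g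
    proof -
      have "x \<notin> ?N i" if "x \<in> ?N j" for x
        using \<open>j \<notin> \<Gamma> i\<close> \<open>j \<noteq> i\<close> that neighbors_sym unfolding \<Gamma>_def by blast
      then have "f x = g x" if "x \<in> ?N j" for x using that \<open>\<And>x. x \<notin> ?N i \<Longrightarrow> f x = g x\<close> by blast
      then show ?thesis unfolding B_def by auto
    qed
    show "{f\<in>PiE (verts G) A. \<forall>x. x \<notin> ?N v \<longrightarrow> f x = h x}
       = (\<lambda>g. override_on h g (?N v)) ` PiE (?N v) A" if "h \<in> PiE (verts G) A" for v h
      using that by (rule PiE_fibre_eq_override[OF neighbors_subset])
    show "real (card {g\<in>PiE (?N v) A. override_on h g (?N v) \<in> B v})
       \<le> (k + m) * (k / (k + m)) ^ \<delta> * card (PiE (?N v) A)" if v: "v \<in> verts G" for v h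
    proof -
      have d: "\<delta> \<le> card (?N v)" using deg[OF v] by (simp add: vdegree_def)
      then have ne: "?N v \<noteq> {}" using pos by auto
      have "{g\<in>PiE (?N v) A. override_on h g (?N v) \<in> B v} = {g\<in>PiE (?N v) A. \<exists>c. \<forall>u\<in>?N v. c \<in> g u}"
        by (auto simp: B_def)
      moreover have "real (card {g\<in>PiE (?N v) A. \<exists>c. \<forall>u\<in>?N v. c \<in> g u})
          \<le> (k + m) * (real k / real (k + m)) ^ card (?N v) * card (PiE (?N v) A)"
        unfolding A_def using ne pos L neighbors_subset
        by (intro common_color_unlikely) (auto simp: subset_iff)
      moreover have "(real k / real (k + m)) ^ card (?N v) \<le> (real k / real (k + m)) ^ \<delta>"
        using d pos by (intro power_decreasing) auto
      then have "(k + m) * (real k / real (k + m)) ^ card (?N v) * card (PiE (?N v) A)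
         \<le> (k + m) * (real k / real (k + m)) ^ \<delta> * card (PiE (?N v) A)"
        by (intro mult_right_mono mult_left_mono) auto
      ultimately show ?thesis by simp
    qed
  qed (use p in auto)
  then obtain L' where L': "L' \<in> PiE (verts G) A" "\<And>v. v \<in> verts G \<Longrightarrow> L' \<notin> B v" by blast
  have L'_sub: "L' v \<subseteq> L v \<and> card (L' v) = k" if "v \<in> verts G" for v
    using L'(1) that by (auto simp: A_def PiE_iff)
  then have "list_assignment G k L'" by (simp add: list_assignment_def)
  then obtain f where f: "proper_coloring G f" "\<And>v. v \<in> verts G \<Longrightarrow> f v \<in> L' v"
    using ch unfolding choosable_def by blast
  have "min 2 (vdegree G v) \<le> card (f ` ?N v)" if v: "v \<in> verts G" for v
  proof (rule ccontr)
    assume "\<not> ?thesis"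
    then have "card (f ` ?N v) \<le> 1" by simp
    moreover have "?N v \<noteq> {}" using deg[OF v] pos by (auto simp: vdegree_def)
    ultimately have "card (f ` ?N v) = 1"
      by (metis card_0_eq finite_imageI finite_neighbors image_is_empty le_antisym less_one linorder_not_le)
    then obtain c where "f ` ?N v = {c}" by (rule card_1_singletonE)
    then have "c \<in> L' u" if "u \<in> ?N v" for u
      using f(2)[of u] that neighbors_subset by (metis image_eqI singletonD subsetD)
    then show False using L'(2)[OF v] by (auto simp: B_def)
  qed
  then have "two_dynamic_coloring G f" using f by (simp add: two_dynamic_coloring_def)
  moreover have "f v \<in> L0 v" if "v \<in> verts G" for v using f(2) L L'_sub that by blast
  ultimately show "\<exists>f. two_dynamic_coloring G f \<and> (\<forall>v\<in>verts G. f v \<in> L0 v)" by blast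
qed

section \<open>Random partial colorings\<close>

text \<open>
  The value \<open>None\<close> means that a vertex is blank. Random partial colorings behave better
  than random proper colorings because a vertex with few open colors is likely to stay blank, and
  then takes no color away from its neighbors.
\<close>
definition partial_colorings :: "('a, 'b) pre_digraph \<Rightarrow> ('a \<Rightarrow> 'c set) \<Rightarrow> ('a \<Rightarrow> 'c option) set" where
  "partial_colorings G L = {f\<in>blank_or_color (verts G) L.
     \<forall>v. \<forall>u\<in>neighbors G v. f u = None \<or> f u \<noteq> f v}"

definition open_colors :: "('a, 'b) pre_digraph \<Rightarrow> ('a \<Rightarrow> 'c set) \<Rightarrow> ('a \<Rightarrow> 'c option) \<Rightarrow> 'a \<Rightarrow> 'c set" where
  "open_colors G L f v = {c\<in>L v. Some c \<notin> f ` neighbors G v}"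

definition blank_neighbors :: "('a, 'b) pre_digraph \<Rightarrow> ('a \<Rightarrow> 'c option) \<Rightarrow> 'a \<Rightarrow> 'a set" where
  "blank_neighbors G f v = {u\<in>neighbors G v. f u = None}"

context graph
begin

text \<open>
  Coloring one blank vertex preserves the hypothesis: each of its neighbors loses at most one open
  color, but also one blank neighbor.
\<close>
lemma complete_partial_coloring:
  assumes "f \<in> partial_colorings G L" and fin: "\<And>v. v \<in> verts G \<Longrightarrow> finite (L v)"
    and "\<And>v. v \<in> verts G \<Longrightarrow> f v = None \<Longrightarrow>
           card (blank_neighbors G f v) < card (open_colors G L f v)"
  shows "\<exists>g. proper_coloring G g \<and> (\<forall>v\<in>verts G. g v \<in> L v)"
  using assms(1,3)
proof (induction "card {v\<in>verts G. f v = None}" arbitrary: f rule: less_induct)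
  case less
  show ?case
  proof (cases "\<exists>v\<in>verts G. f v = None")
    case False
    have Some: "\<exists>a. f v = Some a" if "v \<in> verts G" for v using False that by auto
    have "the (f u) \<noteq> the (f v)" if u: "u \<in> neighbors G v" for u v
    proof -
      have "f u = None \<or> f u \<noteq> f v" using less.prems(1) u unfolding partial_colorings_def by blast
      moreover obtain a where "f u = Some a" using Some neighbor_in_verts[OF u] by blast
      moreover obtain b where "f v = Some b" using Some neighbor_in_verts[OF u] by blast
      ultimately show ?thesis by simp
    qed
    moreover have "the (f v) \<in> L v" if v: "v \<in> verts G" for v
    proof -
      have "f v \<in> insert None (Some ` L v)"
        by (rule PiE_mem[of f "verts G", OF _ v]) (use less.prems(1) in \<open>simp add: partial_colorings_def\<close>)
      moreover obtain a where "f v = Some a" using Some v by blast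
      ultimately show ?thesis by auto
    qed
    ultimately show ?thesis unfolding proper_coloring_iff by (intro exI[of _ "\<lambda>v. the (f v)"]) auto
  next
    case True
    then obtain v where v: "v \<in> verts G" "f v = None" by blast
    then have "open_colors G L f v \<noteq> {}" using less.prems(2)[OF v] by auto
    then obtain c where c: "c \<in> L v" "Some c \<notin> f ` neighbors G v" by (auto simp: open_colors_def)
    let ?f = "f(v := Some c)"
    show ?thesis
    proof (rule less.hyps[of ?f])
      show "card {w\<in>verts G. ?f w = None} < card {w\<in>verts G. f w = None}"
        using v by (intro psubset_card_mono) auto
      have "?f x = None \<or> ?f x \<noteq> ?f w" if x: "x \<in> neighbors G w" for x w
      proof -
        have "f x = None \<or> f x \<noteq> f w" using less.prems(1) x unfolding partial_colorings_def by blast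
        moreover have "x \<noteq> w" using x by auto
        moreover have "f x \<noteq> Some c" if "w = v" using c(2) x that by (metis imageI)
        moreover have "f w \<noteq> Some c" if "x = v" using c(2) neighbor_sym[OF x] that by (metis imageI)
        ultimately show ?thesis unfolding fun_upd_apply by metis
      qed
      moreover have "?f \<in> blank_or_color (verts G) L"
      proof (rule PiE_I)
        have f: "f \<in> blank_or_color (verts G) L"
          using less.prems(1) unfolding partial_colorings_def by blast
        show "?f x \<in> insert None (Some ` L x)" if "x \<in> verts G" for x
          using PiE_mem[OF f that] c(1) unfolding fun_upd_apply by (cases "x = v") auto
        show "?f x = undefined" if "x \<notin> verts G" for x
          using PiE_arb[OF f that] v(1) that by auto
      qed
      ultimately show "?f \<in> partial_colorings G L" unfolding partial_colorings_def by blast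
      fix w assume w: "w \<in> verts G" "?f w = None"
      then have wv: "w \<noteq> v" and fw: "f w = None" by (auto split: if_splits)
      have old: "card (blank_neighbors G f w) < card (open_colors G L f w)" using less.prems(2) w(1) fw by blast
      have finO: "finite (open_colors G L f w)" using fin[OF w(1)] by (simp add: open_colors_def)
      show "card (blank_neighbors G ?f w) < card (open_colors G L ?f w)"
      proof (cases "v \<in> neighbors G w")
        case True
        have "blank_neighbors G ?f w = blank_neighbors G f w - {v}" by (auto simp: blank_neighbors_def)
        moreover have "v \<in> blank_neighbors G f w" using True v by (simp add: blank_neighbors_def)
        moreover have "finite (blank_neighbors G f w)" by (simp add: blank_neighbors_def)
        ultimately have "card (blank_neighbors G ?f w) + 1 = card (blank_neighbors G f w)"
          by (metis Suc_eq_plus1 card_Suc_Diff1)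
        moreover have "open_colors G L f w - {c} \<subseteq> open_colors G L ?f w"
          by (auto simp: open_colors_def split: if_splits)
        then have "card (open_colors G L f w - {c}) \<le> card (open_colors G L ?f w)"
          using fin[OF w(1)] by (intro card_mono) (auto simp: open_colors_def)
        moreover have "card (open_colors G L f w) - 1 \<le> card (open_colors G L f w - {c})"
          using diff_card_le_card_Diff[of "{c}" "open_colors G L f w"] by simp
        ultimately show ?thesis using old by linarith
      next
        case False
        then have "blank_neighbors G ?f w = blank_neighbors G f w" "open_colors G L ?f w = open_colors G L f w"
          by (auto simp: blank_neighbors_def open_colors_def image_iff)
        then show ?thesis using old by simp
      qed
    qed
  qed
qed

lemma blank_in_partial_colorings: "(\<lambda>v\<in>verts G. None) \<in> partial_colorings G L"
proof -
  have "(\<lambda>v\<in>verts G. None) \<in> blank_or_color (verts G) L" by (rule PiE_I) auto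
  moreover have "(\<lambda>v\<in>verts G. None) u = None" if "u \<in> neighbors G v" for u v
    using neighbor_in_verts[OF that] by simp
  ultimately show ?thesis unfolding partial_colorings_def by blast
qed

lemma choosable_Suc_degree:
  assumes "\<And>v. v \<in> verts G \<Longrightarrow> vdegree G v \<le> \<Delta>"
  shows "choosable G (\<Delta> + 1)"
  unfolding choosable_def
proof (intro allI impI)
  fix L0 assume "list_assignment G (\<Delta> + 1) L0"
  then obtain L where L: "\<And>v. v \<in> verts G \<Longrightarrow> L v \<subseteq> L0 v \<and> finite (L v) \<and> card (L v) = \<Delta> + 1"
    by (rule exact_sublists) blast
  let ?f = "\<lambda>v\<in>verts G. None :: nat option"
  have "card (blank_neighbors G ?f v) < card (open_colors G L ?f v)" if v: "v \<in> verts G" for v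
  proof -
    have "card (blank_neighbors G ?f v) \<le> vdegree G v"
      unfolding vdegree_def blank_neighbors_def by (intro card_mono) auto
    moreover have "open_colors G L ?f v = L v"
      using neighbor_in_verts[of _ v] by (auto simp: open_colors_def)
    ultimately show ?thesis using assms[OF v] L[OF v] by simp
  qed
  then have "\<exists>g. proper_coloring G g \<and> (\<forall>v\<in>verts G. g v \<in> L v)"
    using L blank_in_partial_colorings by (intro complete_partial_coloring[of ?f L]) auto
  then show "\<exists>g. proper_coloring G g \<and> (\<forall>v\<in>verts G. g v \<in> L0 v)" using L by blast
qed

text \<open>
  Here triangle-freeness enters: the neighbors of \<open>v\<close> are pairwise nonadjacent, so the open
  colors of each of them are determined by the colors outside the neighborhood of \<open>v\<close>, and
  any simultaneous choice of open colors or blanks is proper.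
\<close>
lemma partial_colorings_fibre:
  assumes "triangle_free G" "h \<in> partial_colorings G L"
  shows "{f\<in>partial_colorings G L. \<forall>x. x \<notin> neighbors G v \<longrightarrow> f x = h x}
    = (\<lambda>g. override_on h g (neighbors G v)) ` blank_or_color (neighbors G v) (open_colors G L h)"
    (is "?F = ?ov ` ?P")
proof (intro equalityI subsetI)
  let ?N = "neighbors G"
  have disj: "?N u \<inter> ?N v = {}" if "u \<in> ?N v" for u using disjoint_neighbors[OF assms(1) that] .
  have h: "h \<in> blank_or_color (verts G) L" "\<And>v u. u \<in> ?N v \<Longrightarrow> h u = None \<or> h u \<noteq> h v"
    using assms(2) unfolding partial_colorings_def by blast+
  {
    fix f assume f: "f \<in> ?F"
    have "f u \<in> insert None (Some ` open_colors G L h u)" if u: "u \<in> ?N v" for u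
    proof (cases "f u")
      case (Some c)
      have "f u \<in> insert None (Some ` L u)"
      proof (rule PiE_mem[of f "verts G"])
        show "f \<in> blank_or_color (verts G) L" using f unfolding partial_colorings_def by blast
        show "u \<in> verts G" using neighbor_in_verts[OF u] by blast
      qed
      then have "c \<in> L u" using Some by auto
      moreover have "Some c \<noteq> h w" if w: "w \<in> ?N u" for w
      proof -
        have "f w = h w" using f w disj[OF u] by blast
        moreover have "f w = None \<or> f w \<noteq> f u" using f w unfolding partial_colorings_def by blast
        ultimately show ?thesis using Some by (cases "h w") auto
      qed
      ultimately show ?thesis using Some by (auto simp: open_colors_def)
    qed simp
    then have "restrict f (?N v) \<in> ?P" unfolding restrict_PiE_iff by blast
    moreover have "f x = ?ov (restrict f (?N v)) x" for x
      using f by (cases "x \<in> ?N v") auto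
    then have "f = ?ov (restrict f (?N v))" by (rule ext)
    ultimately show "f \<in> ?ov ` ?P" by blast
  next
    fix f assume "f \<in> ?ov ` ?P"
    then obtain g where g: "g \<in> ?P" "f = ?ov g" by blast
    have gu: "g u = None \<or> (\<exists>c. g u = Some c \<and> c \<in> L u \<and> (\<forall>w\<in>?N u. h w \<noteq> Some c))"
      if "u \<in> ?N v" for u
    proof -
      have "g u \<in> insert None (Some ` open_colors G L h u)" using PiE_mem[OF g(1) that] .
      then show ?thesis by (force simp: open_colors_def)
    qed
    have "f x \<in> insert None (Some ` L x)" if "x \<in> verts G" for x
    proof (cases "x \<in> ?N v")
      case True
      then show ?thesis using gu[OF True] unfolding g(2) by auto
    next
      case False
      then show ?thesis using PiE_mem[OF h(1) that] unfolding g(2) by simp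
    qed
    moreover have "f x = undefined" if "x \<notin> verts G" for x
      using PiE_arb[OF h(1) that] neighbors_subset[of v] that unfolding g(2)
      by (subst override_on_apply_notin) auto
    ultimately have "f \<in> blank_or_color (verts G) L" by (rule PiE_I)
    moreover have "f x = None \<or> f x \<noteq> f w" if x: "x \<in> ?N w" for x w
    proof -
      have w: "w \<in> ?N x" using neighbor_sym[OF x] .
      consider "x \<in> ?N v" "w \<notin> ?N v" | "x \<notin> ?N v" "w \<in> ?N v" | "x \<notin> ?N v" "w \<notin> ?N v"
        using disj[of x] w by auto
      then show ?thesis
      proof cases
        case 1
        then have "f x = g x" "f w = h w" unfolding g(2) by simp_all
        then show ?thesis using gu[OF 1(1)] w by metis
      next
        case 2
        then have "f x = h x" "f w = g w" unfolding g(2) by simp_all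
        then show ?thesis using gu[OF 2(2)] x by metis
      next
        case 3
        then show ?thesis using h(2)[OF x] unfolding g(2) by simp
      qed
    qed
    ultimately have "f \<in> partial_colorings G L" unfolding partial_colorings_def by blast
    then show "f \<in> ?F" unfolding g(2) by simp
  }
qed

text \<open>
  The local lemma is applied to the event \<open>B v\<close> that \<open>v\<close> has fewer than \<open>l\<close> open colors or
  at least \<open>l\<close> blank neighbors with \<open>l\<close> open colors each; the two summands of \<open>p\<close> bound these two
  possibilities. The restriction in the second one is what makes its probability
  small whatever the coloring is outside the neighborhood of \<open>v\<close>. If no bad event occurs,
  every vertex has \<open>l\<close> open colors, so the restriction is void and each vertex has fewer blank
  neighbors than open colors. As \<open>B v\<close> depends on colors at distance at most 2 from \<open>v\<close>, changing a
  neighborhood affects the events of vertices within distance 3 only.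
\<close>
lemma triangle_free_choosable_criterion:
  fixes q l \<Delta> :: nat and p :: real
  assumes tf: "triangle_free G" and deg: "\<And>v. v \<in> verts G \<Longrightarrow> vdegree G v \<le> \<Delta>"
    and pos: "0 < q" "0 < l"
    and p: "p = 2 ^ l * exp (- (q * exp (- real \<Delta> / q)) / 2) + exp (\<Delta> / l) / 2 ^ l"
      "4 * p * (\<Delta> ^ 2 + \<Delta> ^ 3) \<le> 1" "p < 1/2"
  shows "choosable G q"
  unfolding choosable_def
proof (intro allI impI)
  fix L0 assume "list_assignment G q L0"
  then obtain L where L: "\<And>v. v \<in> verts G \<Longrightarrow> L v \<subseteq> L0 v \<and> finite (L v) \<and> card (L v) = q"
    by (rule exact_sublists) blast
  let ?N = "neighbors G" and ?\<Omega> = "partial_colorings G L"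
  define \<Gamma> where "\<Gamma> v = (\<Union>u\<in>?N v. ?N u) \<union> (\<Union>u\<in>?N v. \<Union>w\<in>?N u. ?N w)" for v
  define B where "B v = {f. card (open_colors G L f v) < l \<or>
     l \<le> card {u\<in>?N v. f u = None \<and> l \<le> card (open_colors G L f u)}}" for v
  have card_N: "card (?N v) \<le> \<Delta>" for v
  proof (cases "v \<in> verts G")
    case True
    then show ?thesis using deg[of v] by (simp add: vdegree_def)
  next
    case False
    then have "?N v = {}" using neighbor_in_verts by blast
    then show ?thesis by simp
  qed
  have "\<exists>f\<in>?\<Omega>. \<forall>v\<in>verts G. f \<notin> B v"
  proof (rule local_lemma_resampling[where X = ?N and A = "\<lambda>v h u. insert None (Some ` open_colors G L h u)"
        and \<Gamma> = \<Gamma> and D = "\<Delta> ^ 2 + \<Delta> ^ 3" and p = p])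
    have "finite (blank_or_color (verts G) L)" using L by (intro finite_PiE) auto
    then show "finite ?\<Omega>" by (simp add: partial_colorings_def)
    show "?\<Omega> \<noteq> {}" using blank_in_partial_colorings by blast
    show "card (verts G \<inter> \<Gamma> v) \<le> \<Delta> ^ 2 + \<Delta> ^ 3" for v
    proof -
      have U: "card (\<Union>u\<in>?N v. F u) \<le> \<Delta> * n" if "\<And>u. card (F u) \<le> n" for F :: "'a \<Rightarrow> 'a set" and n v
      proof -
        have "card (\<Union>u\<in>?N v. F u) \<le> (\<Sum>u\<in>?N v. card (F u))" by (rule card_UN_le) simp
        also have "\<dots> \<le> card (?N v) * n" using sum_bounded_above[of "?N v" "\<lambda>u. card (F u)" n] that by simp
        also have "\<dots> \<le> \<Delta> * n" using card_N by simp
        finally show ?thesis .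
      qed
      have "card (verts G \<inter> \<Gamma> v) \<le> card (\<Gamma> v)" by (intro card_mono) (auto simp: \<Gamma>_def)
      also have "\<dots> \<le> card (\<Union>u\<in>?N v. ?N u) + card (\<Union>u\<in>?N v. \<Union>w\<in>?N u. ?N w)"
        unfolding \<Gamma>_def by (rule card_Un_le)
      also have "\<dots> \<le> \<Delta> * \<Delta> + \<Delta> * (\<Delta> * \<Delta>)" by (intro add_mono U card_N)
      finally show ?thesis by (simp add: power2_eq_square power3_eq_cube)
    qed
    show "f \<in> B j \<longleftrightarrow> g \<in> B j"
      if "j \<notin> \<Gamma> i" "\<And>x. x \<notin> ?N i \<Longrightarrow> f x = g x" for i j f g
    proof -
      have "x \<notin> ?N i" if "x \<in> ?N j" for x
        using \<open>j \<notin> \<Gamma> i\<close> neighbor_sym[OF that] unfolding \<Gamma>_def by blast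
      then have 1: "f x = g x" if "x \<in> ?N j" for x using that \<open>\<And>x. x \<notin> ?N i \<Longrightarrow> f x = g x\<close> by blast
      have "y \<notin> ?N i" if "x \<in> ?N j" "y \<in> ?N x" for x y
        using \<open>j \<notin> \<Gamma> i\<close> that[THEN neighbor_sym] unfolding \<Gamma>_def by blast
      then have 2: "f y = g y" if "x \<in> ?N j" "y \<in> ?N x" for x y
        using that \<open>\<And>x. x \<notin> ?N i \<Longrightarrow> f x = g x\<close> by blast
      have "open_colors G L f j = open_colors G L g j"
        using 1 unfolding open_colors_def by (simp cong: image_cong)
      moreover have "open_colors G L f x = open_colors G L g x" if "x \<in> ?N j" for x
        using 2[OF that] unfolding open_colors_def by (simp cong: image_cong)
      then have "{u\<in>?N j. f u = None \<and> l \<le> card (open_colors G L f u)}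
          = {u\<in>?N j. g u = None \<and> l \<le> card (open_colors G L g u)}" using 1 by auto
      ultimately show ?thesis by (simp add: B_def)
    qed
    show "{f\<in>?\<Omega>. \<forall>x. x \<notin> ?N v \<longrightarrow> f x = h x}
       = (\<lambda>g. override_on h g (?N v)) ` blank_or_color (?N v) (open_colors G L h)"
      if "h \<in> ?\<Omega>" for v h
      by (rule partial_colorings_fibre[OF tf that])
    show "real (card {g\<in>blank_or_color (?N v) (open_colors G L h). override_on h g (?N v) \<in> B v})
       \<le> p * card (blank_or_color (?N v) (open_colors G L h))" if v: "v \<in> verts G" for v h
    proof -
      let ?A = "open_colors G L h"
      let ?P = "blank_or_color (?N v) ?A"
      have fA: "finite (?A u)" if "u \<in> ?N v" for u
        using L[of u] that neighbors_subset[of v] by (auto simp: open_colors_def)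
      have fP: "finite ?P" using fA by (intro finite_PiE) auto
      have o1: "open_colors G L (override_on h g (?N v)) v = {c\<in>L v. Some c \<notin> g ` ?N v}" for g
        by (simp add: open_colors_def cong: image_cong)
      have o2: "open_colors G L (override_on h g (?N v)) u = ?A u" if "u \<in> ?N v" for g u
      proof -
        have "override_on h g (?N v) w = h w" if "w \<in> ?N u" for w
          using disjoint_neighbors[OF tf \<open>u \<in> ?N v\<close>] that by (auto simp: override_on_def)
        then show ?thesis by (simp add: open_colors_def cong: image_cong)
      qed
      have "{u\<in>?N v. override_on h g (?N v) u = None \<and> l \<le> card (open_colors G L (override_on h g (?N v)) u)}
         = {u\<in>?N v. g u = None \<and> l \<le> card (?A u)}" for g
        using o2 by auto
      then have "{g\<in>?P. override_on h g (?N v) \<in> B v}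
         = {g\<in>?P. card {c\<in>L v. Some c \<notin> g ` ?N v} < l}
           \<union> {g\<in>?P. l \<le> card {u\<in>?N v. g u = None \<and> l \<le> card (?A u)}}" (is "_ = ?E1 \<union> ?E2")
        by (auto simp: B_def o1)
      then have "card {g\<in>?P. override_on h g (?N v) \<in> B v} \<le> card ?E1 + card ?E2"
        by (simp only: card_Un_le)
      moreover have "real (card ?E1) \<le> 2 ^ l * exp (- (q * exp (- real \<Delta> / q)) / 2) * card ?P"
        using few_missed_colors_unlikely[of "?N v" ?A "real \<Delta>" "L v" l] fA card_N[of v] L[OF v] pos
        by fastforce
      moreover have "real (card ?E2) \<le> exp (\<Delta> / l) / 2 ^ l * card ?P"
        using fA card_N[of v] pos by (intro many_blanks_unlikely) auto
      ultimately show ?thesis unfolding p(1) distrib_right by linarith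
    qed
    show "0 \<le> p" unfolding p(1) by (intro add_nonneg_nonneg) auto
  qed (use p in auto)
  then obtain f where f: "f \<in> ?\<Omega>" "\<And>v. v \<in> verts G \<Longrightarrow> f \<notin> B v" by blast
  have "card (blank_neighbors G f v) < card (open_colors G L f v)" if v: "v \<in> verts G" for v
  proof -
    have "l \<le> card (open_colors G L f u)" if "u \<in> verts G" for u using f(2)[OF that] by (simp add: B_def)
    then have "blank_neighbors G f v = {u\<in>?N v. f u = None \<and> l \<le> card (open_colors G L f u)}"
      using neighbors_subset by (auto simp: blank_neighbors_def)
    then show ?thesis using f(2)[OF v] by (simp add: B_def)
  qed
  then have "\<exists>g. proper_coloring G g \<and> (\<forall>v\<in>verts G. g v \<in> L v)"
    using f(1) L by (intro complete_partial_coloring[of f L]) auto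
  then show "\<exists>g. proper_coloring G g \<and> (\<forall>v\<in>verts G. g v \<in> L0 v)" using L by blast
qed

end

section \<open>Triangle-free graphs of large maximum degree\<close>

lemma ln_add_one_ge:
  fixes y :: real
  assumes "0 \<le> y"
  shows "2 * y / (2 + y) \<le> ln (1 + y)"
proof -
  have "ln (1 + 0) - 2 * 0 / (2 + 0) \<le> ln (1 + y) - 2 * y / (2 + y)"
  proof (rule DERIV_nonneg_imp_nondecreasing[OF assms])
    fix t :: real assume t: "0 \<le> t" "t \<le> y"
    have "((\<lambda>t. ln (1 + t) - 2 * t / (2 + t)) has_real_derivative
        1 / (1 + t) - (2 * (2 + t) - 2 * t) / (2 + t)\<^sup>2) (at t)"
      using t by (auto intro!: derivative_eq_intros simp: power2_eq_square)
    moreover have "1 / (1 + t) - (2 * (2 + t) - 2 * t) / (2 + t)\<^sup>2 = t\<^sup>2 / ((1 + t) * (2 + t)\<^sup>2)"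
      using t by (simp add: divide_simps power2_eq_square) (simp add: algebra_simps)
    ultimately show "\<exists>D. ((\<lambda>t. ln (1 + t) - 2 * t / (2 + t)) has_real_derivative D) (at t) \<and> 0 \<le> D"
      using t by (intro exI[of _ "t\<^sup>2 / ((1 + t) * (2 + t)\<^sup>2)"]) auto
  qed
  then show ?thesis by simp
qed

text \<open>
  The criterion holds with \<open>l\<close> about \<open>2 \<surd>\<Delta>\<close>. On the one hand \<open>\<Delta> / l \<le> l / 4\<close>, so that many
  blanks have probability at most \<open>exp (l / 4) / 2 ^ l\<close>. On the other hand, for
  \<open>q = 16 \<Delta> / ln \<Delta>\<close> the expected number of open colors is at least \<open>16 \<Delta> powr (15/16) / ln \<Delta>\<close>,
  which exceeds \<open>6 l\<close>. Both failure probabilities are exponentially small in \<open>\<surd>\<Delta>\<close>, against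
  only polynomially many dependent events.
\<close>
lemma (in graph) triangle_free_choosable:
  fixes \<Delta> :: nat
  assumes tf: "triangle_free G" and deg: "\<And>v. v \<in> verts G \<Longrightarrow> vdegree G v \<le> \<Delta>"
    and large: "18 \<le> ln \<Delta>"
  shows "choosable G (nat \<lceil>16 * real \<Delta> / ln (real \<Delta>)\<rceil>)"
proof -
  define x where "x = ln (real \<Delta>)"
  have x: "18 \<le> x" using large by (simp add: x_def)
  have "\<Delta> \<noteq> 0" using large by (intro notI) simp
  then have D: "real \<Delta> = exp x" by (simp add: x_def)
  define s where "s = exp (x / 2)"
  have s2: "real \<Delta> = s * s" by (simp add: D s_def flip: exp_add)
  define q where "q = nat \<lceil>16 * real \<Delta> / x\<rceil>"
  define l where "l = nat \<lceil>2 * s\<rceil>"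
  have s_pos: "0 < s" by (simp add: s_def)
  \<comment> \<open>\<open>s = \<surd>\<Delta>\<close> dominates \<open>x = ln \<Delta>\<close>; the factor 11 leaves room for all later estimates.\<close>
  have s_large: "11 * x \<le> s"
  proof -
    have e: "1 + x/4 + (x/4)\<^sup>2 / 2 \<le> exp (x / 4)" using x by (intro exp_lower_Taylor_quadratic) auto
    have "4/5 * x \<le> x/4 + (x/4)\<^sup>2 / 2"
      using mult_mono[OF x order_refl, of x] x by (simp add: power2_eq_square field_simps)
    then have "4/5 * x \<le> exp (x / 4)" using e by simp
    then have "(4/5 * x) * (4/5 * x) \<le> exp (x/4) * exp (x/4)" using x by (intro mult_mono) auto
    also have "\<dots> = s" by (simp add: s_def flip: exp_add)
    finally have "16/25 * (x * x) \<le> s" by simp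
    moreover have "18 * x \<le> x * x" using x by (intro mult_right_mono) auto
    ultimately show ?thesis using x by linarith
  qed
  have l: "2 * s \<le> l" "l \<le> 3 * s"
  proof -
    show "2 * s \<le> l" unfolding l_def by linarith
    have "real l < 2 * s + 1" unfolding l_def using s_pos by linarith
    then show "l \<le> 3 * s" using s_large x by linarith
  qed
  have q: "16 * real \<Delta> / x \<le> q" unfolding q_def by linarith
  have D_pos: "0 < real \<Delta>" by (simp add: D)
  have q_pos: "0 < real q"
  proof -
    have "0 < 16 * real \<Delta> / x" using x D_pos by simp
    then show ?thesis using q by linarith
  qed
  have mu: "6 * l \<le> q * exp (- real \<Delta> / q)"
  proof -
    have "real \<Delta> / q \<le> x / 16" using q q_pos x by (simp add: field_simps)
    then have "(16 * exp x / x) * exp (- (x / 16)) \<le> q * exp (- real \<Delta> / q)"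
      using q x by (intro mult_mono) (auto simp: D)
    moreover have "18 * exp (x/2) \<le> (16 * exp x / x) * exp (- (x / 16))"
    proof -
      have "1 + 7*x/16 + (7*x/16)\<^sup>2 / 2 \<le> exp (7*x/16)" using x by (intro exp_lower_Taylor_quadratic) auto
      moreover have "3/2 * x \<le> (7*x/16)\<^sup>2 / 2"
        using mult_mono[OF x order_refl, of x] x by (simp add: power2_eq_square field_simps)
      ultimately have "18 * x \<le> 16 * exp (7*x/16)" using x by linarith
      then have "18 * exp (x/2) * x \<le> 16 * exp (7*x/16) * exp (x/2)" by simp
      also have "\<dots> = 16 * exp x * exp (- (x / 16))" by (simp add: mult.assoc flip: exp_add)
      finally show ?thesis using x by (simp add: field_simps)
    qed
    ultimately show ?thesis using l(2) by (simp add: s_def)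
  qed
  define p where "p = 2 ^ l * exp (- (q * exp (- real \<Delta> / q)) / 2) + exp (\<Delta> / l) / 2 ^ l"
  have two: "(2::real) ^ l = exp (l * ln 2)" by (simp add: exp_of_nat_mult)
  have ln2: "2/3 \<le> ln (2::real)" "ln (2::real) \<le> 1" using ln_add_one_ge[of 1] ln_2_less_1 by auto
  have p_le: "p \<le> 2 * exp (- 9 * x)"
  proof -
    have "2 ^ l * exp (- (q * exp (- real \<Delta> / q)) / 2) = exp (l * ln 2 - (q * exp (- real \<Delta> / q)) / 2)"
      by (simp add: two flip: exp_add)
    also have "\<dots> \<le> exp (- 9 * x)"
    proof -
      have "l * ln 2 \<le> real l" using ln2 by (simp add: mult_left_le)
      then have "l * ln 2 - (q * exp (- real \<Delta> / q)) / 2 \<le> - 9 * x"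
        using mu l s_large x by linarith
      then show ?thesis by (simp only: exp_le_cancel_iff)
    qed
    finally have 1: "2 ^ l * exp (- (q * exp (- real \<Delta> / q)) / 2) \<le> exp (- 9 * x)" .
    have "exp (\<Delta> / l) / 2 ^ l = exp (\<Delta> / l - l * ln 2)" by (simp add: two exp_diff)
    also have "\<dots> \<le> exp (- 9 * x)"
    proof -
      have "(2 * s) * (2 * s) \<le> real l * l" using l s_pos by (intro mult_mono) auto
      then have "\<Delta> / l \<le> l / 4" using l s_pos by (simp add: s2 field_simps)
      moreover have "2/3 * l \<le> l * ln 2" using mult_left_mono[OF ln2(1), of "real l"] by (simp add: mult.commute)
      ultimately have "\<Delta> / l - l * ln 2 \<le> - 9 * x" using l s_large x by linarith
      then show ?thesis by (simp only: exp_le_cancel_iff)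
    qed
    finally show ?thesis using 1 by (simp add: p_def)
  qed
  have small: "16 * exp (- 6 * x) \<le> 1"
  proof -
    have "16 \<le> exp (6 * x)" using exp_ge_add_one_self[of "6 * x"] x by linarith
    then show ?thesis by (simp add: exp_minus field_simps)
  qed
  have "choosable G q"
  proof (rule triangle_free_choosable_criterion[OF tf deg _ _ p_def])
    show "0 < q" "0 < l" using q_pos l s_pos by (auto intro: gr0I)
    have "4 * p * real (\<Delta>\<^sup>2 + \<Delta> ^ 3) \<le> 4 * (2 * exp (- 9 * x)) * (exp (3 * x) + exp (3 * x))"
    proof (rule mult_mono)
      have "real \<Delta> ^ 2 = exp (2 * x)" "real \<Delta> ^ 3 = exp (3 * x)" by (simp_all add: D flip: exp_of_nat_mult)
      then show "real (\<Delta>\<^sup>2 + \<Delta> ^ 3) \<le> exp (3 * x) + exp (3 * x)" using x by simp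
    qed (use p_le in auto)
    also have "\<dots> = 16 * exp (- 6 * x)" by (simp flip: exp_add)
    finally show "4 * p * real (\<Delta>\<^sup>2 + \<Delta> ^ 3) \<le> 1" using small by simp
    have "exp (- 9 * x) \<le> exp (- 6 * x)" using x by simp
    then show "p < 1/2" using p_le small by linarith
  qed
  then show ?thesis by (simp add: q_def x_def)
qed

section \<open>The size of the extra lists\<close>

text \<open>
  The left side equals \<open>4 \<Delta>\<^sup>2 k (k / (k + m)) ^ (\<delta> - 1)\<close>. In this form it is visibly increasing in
  \<open>k\<close>, so upper bounds \<open>K\<close> for \<open>k\<close> and lower bounds \<open>M\<close> for \<open>m / k\<close> may be inserted.
\<close>
lemma sublist_condition:
  fixes k m K M \<Delta> :: real
  assumes "0 < k" "k \<le> K" "0 \<le> M" "M \<le> m / k" "0 < \<delta>" "0 < \<Delta>"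
    and le: "ln (4 * K * \<Delta>\<^sup>2) \<le> (real \<delta> - 1) * (2 * M / (2 + M))"
  shows "4 * ((k + m) * (k / (k + m)) ^ \<delta>) * \<Delta>\<^sup>2 \<le> 1"
proof -
  have m: "0 \<le> m" using assms by (metis divide_less_0_iff linorder_not_le order_trans less_le_trans)
  have "k / (k + m) = 1 / (1 + m / k)" using assms m by (simp add: field_simps)
  also have "\<dots> = exp (- ln (1 + m / k))" using assms m by (simp add: exp_minus inverse_eq_divide add_pos_nonneg)
  also have "\<dots> \<le> exp (- (2 * M / (2 + M)))"
  proof -
    have "2 * M / (2 + M) \<le> ln (1 + M)" using assms by (intro ln_add_one_ge)
    also have "\<dots> \<le> ln (1 + m / k)" using assms by (subst ln_le_cancel_iff) auto
    finally show ?thesis by simp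
  qed
  finally have r: "k / (k + m) \<le> exp (- (2 * M / (2 + M)))" .
  obtain e where e: "\<delta> = Suc e" using assms by (cases \<delta>) auto
  have "(k + m) * (k / (k + m)) ^ \<delta> = k * (k / (k + m)) ^ e" using assms m by (simp add: e)
  also have "\<dots> \<le> K * exp (- (2 * M / (2 + M))) ^ e"
    using assms m r by (intro mult_mono power_mono) auto
  also have "\<dots> = K * exp (- ((real \<delta> - 1) * (2 * M / (2 + M))))" by (simp add: e flip: exp_of_nat_mult)
  also have "\<dots> \<le> K * exp (- ln (4 * K * \<Delta>\<^sup>2))" using le assms by (intro mult_left_mono) auto
  also have "\<dots> = 1 / (4 * \<Delta>\<^sup>2)" using assms by (simp add: exp_minus field_simps)
  finally show ?thesis using assms by (simp add: field_simps)
qed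

text \<open>
  As \<open>k \<le> \<Delta> + 1 \<le> 15/14 \<Delta>\<close> and \<open>m \<ge> 85 \<Delta> / \<delta>\<close>, the ratio \<open>m / k\<close> is at least \<open>79 / \<delta>\<close>, and it is
  enough that \<open>3 ln \<Delta> + 2 \<le> 158 (\<delta> - 1) / (2 \<delta> + 79)\<close>. Up to \<open>\<delta> = 105\<close> the right side is at
  least \<open>\<delta> / 2 + 1\<close>, which is enough by the hypothesis relating \<open>\<delta>\<close> and \<open>\<Delta>\<close>; from
  \<open>\<delta> = 106\<close> on it is at least \<open>56 = 3 * 18 + 2\<close>.
\<close>
lemma sublist_condition_small:
  fixes \<delta> \<Delta> k m :: nat
  assumes \<Delta>: "14 \<le> \<Delta>" "\<delta> \<le> \<Delta>" and \<delta>: "14 \<le> \<delta>" "6 * ln \<Delta> + 2 \<le> real \<delta>"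
    and small: "ln \<Delta> < 18" and k: "0 < k" "k \<le> \<Delta> + 1" and m: "86 * real \<Delta> / \<delta> < m + 1"
  shows "4 * ((k + m) * (k / (k + m)) ^ \<delta>) * (real \<Delta>)\<^sup>2 \<le> 1"
proof -
  have "real \<Delta> / \<delta> \<ge> 1" using \<Delta> \<delta> by (simp add: field_simps)
  then have m85: "85 * real \<Delta> / \<delta> \<le> m" using m by simp
  have K: "real k \<le> 15/14 * \<Delta>" using k \<Delta> by linarith
  have "79 / \<delta> \<le> (85 * real \<Delta> / \<delta>) / (15/14 * \<Delta>)" using \<Delta> \<delta> by (simp add: field_simps)
  also have "\<dots> \<le> m / k" using m85 K k \<Delta> by (intro frac_le) auto
  finally have M: "79 / \<delta> \<le> m / k" .
  have "4 * (15/14 * \<Delta>) * (real \<Delta>)\<^sup>2 = 30/7 * real \<Delta> ^ 3"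
    by (simp add: power2_eq_square power3_eq_cube)
  then have "ln (4 * (15/14 * \<Delta>) * (real \<Delta>)\<^sup>2) = ln (30/7) + 3 * ln \<Delta>"
    using \<Delta> by (simp only: ln_mult ln_realpow) (simp add: ln_mult_pos ln_realpow)
  also have "\<dots> \<le> 2 + 3 * ln \<Delta>"
  proof -
    have "30/7 \<le> exp (2::real)" using exp_lower_Taylor_quadratic[of 2] by simp
    then have "ln (30/7 :: real) \<le> ln (exp (2::real))" by (subst ln_le_cancel_iff) auto
    then show ?thesis by simp
  qed
  also have "2 + 3 * ln \<Delta> \<le> (real \<delta> - 1) * (2 * (79 / \<delta>) / (2 + 79 / \<delta>))"
  proof -
    have eq: "(real \<delta> - 1) * (2 * (79 / \<delta>) / (2 + 79 / \<delta>)) = 158 * (real \<delta> - 1) / (2 * real \<delta> + 79)"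
      using \<delta> by (simp add: field_simps)
    show ?thesis
    proof (cases "\<delta> \<le> 105")
      case True
      have "0 \<le> (real \<delta> - 14) * (105 - real \<delta>)" using True \<delta> by (intro mult_nonneg_nonneg) auto
      then have "(1 + real \<delta> / 2) * (2 * real \<delta> + 79) \<le> 158 * (real \<delta> - 1)"
        using True \<delta> by (simp add: algebra_simps)
      then have "1 + real \<delta> / 2 \<le> 158 * (real \<delta> - 1) / (2 * real \<delta> + 79)" by (simp add: pos_le_divide_eq)
      then show ?thesis using \<delta> unfolding eq by linarith
    next
      case False
      then have "56 * (2 * real \<delta> + 79) \<le> 158 * (real \<delta> - 1)" by simp
      then have "56 \<le> 158 * (real \<delta> - 1) / (2 * real \<delta> + 79)" by (simp add: pos_le_divide_eq)
      then show ?thesis using small unfolding eq by linarith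
    qed
  qed
  finally have ln: "ln (4 * (15/14 * \<Delta>) * (real \<Delta>)\<^sup>2) \<le> (real \<delta> - 1) * (2 * (79 / \<delta>) / (2 + 79 / \<delta>))" .
  have "4 * ((real k + real m) * (real k / (real k + real m)) ^ \<delta>) * (real \<Delta>)\<^sup>2 \<le> 1"
    by (rule sublist_condition[OF _ K _ M _ _ ln]) (use k \<Delta> \<delta> in auto)
  then show ?thesis by simp
qed

text \<open>
  With \<open>k\<close> of order \<open>\<Delta> / ln \<Delta>\<close> the ratio \<open>m / k\<close> is of order \<open>ln \<Delta> / \<delta>\<close>, so that
  \<open>(k / (k + m)) ^ \<delta>\<close> is at most a power of \<open>1 / \<Delta>\<close>, and the constants make its exponent larger
  than \<open>3\<close>. The rounding in the bound for \<open>k\<close> is paid for by replacing 16 with 18, and the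
  rounding in \<open>m\<close> by replacing 86 with 85.
\<close>
lemma sublist_condition_large:
  fixes \<delta> \<Delta> k m :: nat
  assumes \<Delta>: "\<delta> \<le> \<Delta>" and \<delta>: "6 * ln \<Delta> + 2 \<le> real \<delta>"
    and large: "18 \<le> ln \<Delta>" and k: "0 < k" "k \<le> nat \<lceil>16 * real \<Delta> / ln (real \<Delta>)\<rceil>"
    and m: "86 * real \<Delta> / \<delta> < m + 1"
  shows "4 * ((k + m) * (k / (k + m)) ^ \<delta>) * (real \<Delta>)\<^sup>2 \<le> 1"
proof -
  define x where "x = ln (real \<Delta>)"
  have x: "18 \<le> x" "6 * x + 2 \<le> \<delta>" using large \<delta> by (simp_all add: x_def)
  have d: "110 \<le> real \<delta>" using x by linarith
  have D: "110 \<le> real \<Delta>" using d \<Delta> by linarith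
  have xD: "x \<le> \<Delta>" using x d \<Delta> by linarith
  have "real \<Delta> / \<delta> \<ge> 1" using \<Delta> d by (simp add: field_simps)
  then have m85: "85 * real \<Delta> / \<delta> \<le> m" using m by simp
  have K: "real k \<le> 18 * real \<Delta> / x"
  proof -
    have "0 \<le> 16 * real \<Delta> / x" using x by simp
    then have "real k \<le> 16 * real \<Delta> / x + 1" using k(2) unfolding x_def[symmetric] by linarith
    moreover have "1 \<le> \<Delta> / x" using x xD by simp
    ultimately show ?thesis by simp
  qed
  let ?M = "85 * x / (18 * real \<delta>)"
  have "?M = (85 * real \<Delta> / \<delta>) / (18 * real \<Delta> / x)" using D d x by (simp add: field_simps)
  also have "\<dots> \<le> m / k" using m85 K k D x by (intro frac_le) auto
  finally have M: "?M \<le> m / k" .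
  have "4 * (18 * real \<Delta> / x) * (real \<Delta>)\<^sup>2 \<le> 4 * real \<Delta> * (real \<Delta>)\<^sup>2"
    using x D by (intro mult_right_mono) (auto simp: field_simps)
  then have "ln (4 * (18 * real \<Delta> / x) * (real \<Delta>)\<^sup>2) \<le> ln (4 * real \<Delta> * (real \<Delta>)\<^sup>2)"
    using x D by (subst ln_le_cancel_iff) auto
  also have "\<dots> = ln 4 + 3 * x"
    using D by (simp add: ln_mult ln_realpow power2_eq_square x_def)
  also have "\<dots> \<le> 2 + 3 * x"
  proof -
    have "4 \<le> exp (2::real)" using exp_lower_Taylor_quadratic[of 2] by simp
    then have "ln (4 :: real) \<le> ln (exp (2::real))" by (subst ln_le_cancel_iff) auto
    then show ?thesis by simp
  qed
  also have "2 + 3 * x \<le> (real \<delta> - 1) * (2 * ?M / (2 + ?M))"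
  proof -
    have eq: "(real \<delta> - 1) * (2 * ?M / (2 + ?M)) = 170 * x * (real \<delta> - 1) / (36 * real \<delta> + 85 * x)"
    proof -
      have "2 * ?M / (2 + ?M) = 170 * x / (36 * real \<delta> + 85 * x)"
        using d x by (simp add: divide_simps add_pos_pos)
      then show ?thesis by (simp add: mult_ac)
    qed
    have "(2 + 3 * x) * (36 * real \<delta> + 85 * x) \<le> (28/9 * x) * (51 * real \<delta>)"
      using x d by (intro mult_mono) auto
    also have "\<dots> = 170 * x * (real \<delta> * (1428 / 1530))" by simp
    also have "\<dots> \<le> 170 * x * (real \<delta> - 1)" using x d by (intro mult_left_mono) auto
    finally show ?thesis unfolding eq using x d by (simp add: pos_le_divide_eq add_pos_pos)
  qed
  finally have ln: "ln (4 * (18 * real \<Delta> / x) * (real \<Delta>)\<^sup>2) \<le> (real \<delta> - 1) * (2 * ?M / (2 + ?M))" .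
  have "4 * ((real k + real m) * (real k / (real k + real m)) ^ \<delta>) * (real \<Delta>)\<^sup>2 \<le> 1"
    by (rule sublist_condition[OF _ K _ M _ _ ln]) (use k D d x in auto)
  then show ?thesis by simp
qed

text \<open>
  Bootstrapping: a lower bound \<open>2 ^ j\<close> for \<open>\<Delta>\<close> yields \<open>4 j + 2 \<le> \<delta> \<le> \<Delta>\<close>, which is
  at least \<open>2 ^ (j + 1)\<close> for \<open>j \<le> 2\<close>.
\<close>
lemma fourteen_le_degree:
  fixes \<delta> \<Delta> :: nat
  assumes "1 \<le> \<Delta>" "\<delta> \<le> \<Delta>" "6 * ln \<Delta> + 2 \<le> real \<delta>"
  shows "14 \<le> \<delta>"
proof -
  have ln2: "2/3 \<le> ln (2::real)" using ln_add_one_ge[of 1] by simp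
  have step: "real j * 4 + 2 \<le> \<delta>" if "2 ^ j \<le> \<Delta>" for j
  proof -
    have "ln ((2::real) ^ j) \<le> ln \<Delta>"
      using that assms(1) by (subst ln_le_cancel_iff) (auto simp flip: of_nat_power_le_of_nat_cancel_iff)
    then have "real j * ln 2 \<le> ln \<Delta>" by (simp add: ln_realpow)
    moreover have "real j * (2/3) \<le> real j * ln 2" using ln2 by (intro mult_left_mono) auto
    ultimately show ?thesis using assms(3) by linarith
  qed
  have "2 \<le> \<delta>" using step[of 0] assms by simp
  then have "6 \<le> \<delta>" using step[of 1] assms by simp
  then have "10 \<le> \<delta>" using step[of 2] assms by simp
  then show ?thesis using step[of 3] assms by simp
qed

text \<open>
  The left side is increasing in \<open>k\<close>, which leaves the case \<open>k = d + 1\<close> to be computed for each \<open>d\<close>.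
  The case \<open>d = 2\<close> is tight enough to need \<open>d (d - 1)\<close> in place of \<open>d\<^sup>2\<close>.
\<close>
lemma small_regular_condition:
  fixes d k :: nat
  assumes d: "2 \<le> d" "d \<le> 21" and k: "0 < k" "k \<le> d + 1"
  shows "4 * ((k + 86) * (k / (k + 86)) ^ d) * real (d * (d - 1)) \<le> 1"
proof -
  obtain e where e: "d = Suc e" using d by (cases d) auto
  have "(real k + 86) * (k / (real k + 86)) ^ d = k * (k / (real k + 86)) ^ e"
    using k by (simp add: e)
  also have "\<dots> \<le> (real d + 1) * ((real d + 1) / (real d + 87)) ^ e"
    using k by (intro mult_mono power_mono) (auto simp: field_simps)
  finally have "4 * ((real k + 86) * (k / (real k + 86)) ^ d) * real (d * e)
     \<le> 4 * ((real d + 1) * ((real d + 1) / (real d + 87)) ^ e) * real (d * e)"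
    by (intro mult_right_mono mult_left_mono) auto
  also have "\<dots> \<le> 1"
  proof -
    have "e \<in> {1,2,3,4,5,6,7,8,9,10,11,12,13,14,15,16,17,18,19,20}"
      using d unfolding e insert_iff empty_iff by presburger
    then show ?thesis unfolding e by (elim insertE emptyE; hypsubst) (simp_all add: power_divide)
  qed
  finally show ?thesis by (simp add: e)
qed

text \<open>
  The tangent to \<open>ln\<close> at \<open>32 = 2 ^ 5\<close> stays below the line \<open>(d - 2) / 6\<close> from 22 on.
\<close>
lemma six_ln_le:
  fixes d :: nat
  assumes "22 \<le> d"
  shows "6 * ln d + 2 \<le> real d"
proof -
  have "ln (real d) = ln (real d / 32) + ln ((2::real) ^ 5)" using assms by (simp add: ln_div)
  also have "ln ((2::real) ^ 5) = 5 * ln 2" by (simp only: ln_realpow)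
  also have "ln (real d / 32) \<le> real d / 32 - 1" using assms by (intro ln_le_minus_one) auto
  finally have "ln (real d) \<le> real d / 32 - 1 + 5 * ln 2" by simp
  moreover have "ln 2 \<le> (18/25 :: real)"
  proof -
    have "1 + 9/25 + (9/25)\<^sup>2 / 2 \<le> exp (9/25 :: real)" by (rule exp_lower_Taylor_quadratic) simp
    then have "(1 + 9/25 + (9/25)\<^sup>2 / 2) * (1 + 9/25 + (9/25)\<^sup>2 / 2) \<le> exp (9/25 :: real) * exp (9/25)"
      by (intro mult_mono) auto
    also have "\<dots> = exp (18/25)" by (simp flip: exp_add)
    finally have "ln 2 \<le> ln (exp (18/25 :: real))" by (subst ln_le_cancel_iff) (auto simp: power2_eq_square)
    then show ?thesis by simp
  qed
  ultimately show ?thesis using assms by simp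
qed

section \<open>From the choice number to 2-dynamic choosability\<close>

lemma choosable_mono: "choosable G k \<Longrightarrow> k \<le> k' \<Longrightarrow> choosable G k'"
  unfolding choosable_def list_assignment_def by fastforce

lemma ch2_le: "two_dynamic_choosable G k \<Longrightarrow> 0 < k \<Longrightarrow> ch2 G \<le> k"
  unfolding ch2_def by (rule Least_le) simp

context graph
begin

lemma degree_bounds:
  assumes "v \<in> verts G"
  shows "min_degree G \<le> vdegree G v" "vdegree G v \<le> max_degree G"
  using assms unfolding min_degree_def max_degree_def by auto

lemma choosable_ch: "choosable G (ch G)"
  unfolding ch_def by (rule LeastI, rule choosable_Suc_degree, rule degree_bounds(2))

lemma ch_pos:
  assumes "verts G \<noteq> {}"
  shows "0 < ch G"
proof (rule gr0I)
  assume "ch G = 0"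
  then have "choosable G 0" using choosable_ch by simp
  then show False using assms unfolding choosable_def list_assignment_def
    by (auto dest: spec[of _ "\<lambda>_. {}"])
qed

lemma ch_le: "choosable G k \<Longrightarrow> ch G \<le> k"
  unfolding ch_def by (rule Least_le)

lemma ch2_le_ch_add:
  assumes ne: "verts G \<noteq> {}" and "2 \<le> max_degree G" "0 < min_degree G"
    and c: "4 * ((ch G + m) * (ch G / (ch G + m)) ^ min_degree G)
           * real (max_degree G * (max_degree G - 1)) \<le> 1"
  shows "ch2 G \<le> ch G + m"
proof (rule ch2_le[OF two_dynamic_choosable_if_sublists[OF choosable_ch, of "min_degree G" "max_degree G"]])
  let ?P = "(ch G + m) * (ch G / (ch G + m)) ^ min_degree G" and ?d = "max_degree G * (max_degree G - 1)"
  have "2 * 1 \<le> ?d" using assms(2) by (intro mult_mono) auto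
  then have "2 \<le> real ?d" by (subst of_nat_numeral[symmetric], subst of_nat_le_iff) simp
  then have "4 * ?P * 2 \<le> 4 * ?P * real ?d" by (rule mult_left_mono) simp
  then show "?P < 1/2" using c by linarith
qed (use assms ch_pos[OF ne] degree_bounds in auto)

theorem ch2_le_of_min_degree:
  assumes tf: "triangle_free G" and ne: "verts G \<noteq> {}" and \<Delta>: "1 \<le> max_degree G"
    and \<delta>: "6 * ln (max_degree G) + 2 \<le> real (min_degree G)"
  shows "real (ch2 G) \<le> real (ch G) + 86 * real (max_degree G) / real (min_degree G)"
proof -
  let ?\<Delta> = "max_degree G" and ?\<delta> = "min_degree G"
  obtain v where "v \<in> verts G" using ne by blast
  then have le: "?\<delta> \<le> ?\<Delta>" using degree_bounds order_trans by blast
  have \<delta>14: "14 \<le> ?\<delta>" using fourteen_le_degree[OF \<Delta> le \<delta>] .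
  define m where "m = nat \<lfloor>86 * real ?\<Delta> / ?\<delta>\<rfloor>"
  have "0 \<le> 86 * real ?\<Delta> / ?\<delta>" by simp
  then have m: "m \<le> 86 * real ?\<Delta> / ?\<delta>" "86 * real ?\<Delta> / ?\<delta> < m + 1"
    unfolding m_def by linarith+
  have "4 * ((ch G + m) * (ch G / (ch G + m)) ^ ?\<delta>) * (real ?\<Delta>)\<^sup>2 \<le> 1"
  proof (cases "ln ?\<Delta> < 18")
    case True
    have "ch G \<le> ?\<Delta> + 1" by (intro ch_le choosable_Suc_degree degree_bounds)
    then show ?thesis
      using sublist_condition_small[OF _ le \<delta>14 \<delta> True ch_pos[OF ne] _ m(2)] le \<delta>14 by simp
  next
    case False
    then have "ch G \<le> nat \<lceil>16 * real ?\<Delta> / ln (real ?\<Delta>)\<rceil>"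
      by (intro ch_le triangle_free_choosable[OF tf] degree_bounds) auto
    then show ?thesis
      using sublist_condition_large[OF le \<delta> _ ch_pos[OF ne] _ m(2)] False by simp
  qed
  moreover have "4 * ((ch G + m) * (ch G / (ch G + m)) ^ ?\<delta>) * real (?\<Delta> * (?\<Delta> - 1))
     \<le> 4 * ((ch G + m) * (ch G / (ch G + m)) ^ ?\<delta>) * (real ?\<Delta>)\<^sup>2"
    by (intro mult_left_mono) (auto simp: power2_eq_square simp flip: of_nat_mult)
  ultimately have "4 * ((ch G + m) * (ch G / (ch G + m)) ^ ?\<delta>) * real (?\<Delta> * (?\<Delta> - 1)) \<le> 1"
    by (rule order_trans[rotated])
  then have "ch2 G \<le> ch G + m" using ne \<delta>14 le by (intro ch2_le_ch_add) auto
  then show ?thesis using m(1) by linarith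
qed

lemma two_dynamic_if_degree_le_1:
  assumes "\<And>v. v \<in> verts G \<Longrightarrow> vdegree G v \<le> 1" "proper_coloring G f"
  shows "two_dynamic_coloring G f"
proof -
  have "min 2 (vdegree G v) \<le> card (f ` neighbors G v)" if "v \<in> verts G" for v
  proof (cases "neighbors G v = {}")
    case False
    then have "0 < card (f ` neighbors G v)" by (simp add: card_gt_0_iff)
    then show ?thesis using assms(1)[OF that] by simp
  qed (simp add: vdegree_def)
  then show ?thesis using assms(2) by (simp add: two_dynamic_coloring_def)
qed

theorem ch2_le_of_regular:
  assumes tf: "triangle_free G" and reg: "regular G"
  shows "ch2 G \<le> ch G + 86"
proof (cases "\<forall>v\<in>verts G. vdegree G v \<le> 1")
  case True
  have "choosable G (ch G + 86)" using choosable_mono[OF choosable_ch] by simp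
  then have "two_dynamic_choosable G (ch G + 86)"
    using two_dynamic_if_degree_le_1 True unfolding choosable_def two_dynamic_choosable_def by metis
  then show ?thesis by (intro ch2_le) auto
next
  case False
  then obtain v where v: "v \<in> verts G" "2 \<le> vdegree G v" by force
  then have ne: "verts G \<noteq> {}" by blast
  have eq: "min_degree G = max_degree G" using reg by (simp add: regular_def)
  have d2: "2 \<le> max_degree G" using degree_bounds(2)[OF v(1)] v(2) by simp
  show ?thesis
  proof (cases "max_degree G \<le> 21")
    case True
    have "ch G \<le> max_degree G + 1" by (intro ch_le choosable_Suc_degree degree_bounds)
    then have "4 * ((ch G + 86) * (ch G / (ch G + 86)) ^ max_degree G)
           * real (max_degree G * (max_degree G - 1)) \<le> 1"
      by (intro small_regular_condition d2 True ch_pos[OF ne])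
    then show ?thesis using ne d2 eq by (intro ch2_le_ch_add) auto
  next
    case False
    then have "6 * ln (max_degree G) + 2 \<le> real (min_degree G)" unfolding eq by (intro six_ln_le) simp
    then have "real (ch2 G) \<le> real (ch G) + 86 * real (max_degree G) / real (min_degree G)"
      using d2 by (intro ch2_le_of_min_degree[OF tf ne]) auto
    then show ?thesis using d2 unfolding eq by simp
  qed
qed

end

theorem theorem4p4:
  fixes G :: "('a, 'b) pre_digraph"
  assumes "graph G" and "triangle_free G"
  shows "(verts G \<noteq> {} \<and> max_degree G \<ge> 1 \<and>
            real (min_degree G) \<ge> 6 * ln (real (max_degree G)) + 2 \<longrightarrow>
          real (ch2 G) \<le> real (ch G) + 86 * real (max_degree G) / real (min_degree G)) \<and>
         (regular G \<longrightarrow> ch2 G \<le> ch G + 86)"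
proof -
  interpret graph G by fact
  show ?thesis using ch2_le_of_min_degree[OF assms(2)] ch2_le_of_regular[OF assms(2)] by blast
qed

end
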